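(* Let $L\ge10$ and $\alpha=1/4$. Set $\hat x_{-1}=0$ and $\hat x_i=\sum_{j=0}^iL^j=\frac{L^{i+1}-1}{L-1}$ for $i\in\mathbb{N}_0=\{0,1,2,\dots\}$, and define $$h(x)=\begin{cases}0,& x\in\bigcup_{i\in\mathbb{N}_0}[\hat x_{2i-1},\hat x_{2i}],\\ (1-\alpha)L,& x\in\bigcup_{i\in\mathbb{N}_0}[\hat x_{2i},\hat x_{2i+1}]\end{cases}$$ (the values at the common endpoints are immaterial). Then there exists a physical solution $\Lambda$ on $[0,\infty)$ to the McKean–Vlasov system with initial density $h$, and a sequence $t_i\uparrow\infty$ such that $\Delta\Lambda_{t_i}>0$ for all $i\in\mathbb{N}$.
   Context: A solution on $[0,\infty)$ of the McKean–Vlasov system with initial density $g$ (here $g=h$) is a nondecreasing cadlag function $\Lambda:[0,\infty)\to[0,\infty)$, with the convention $\Lambda_{0^-}=0$, such that, with $B$ a standard Brownian motion, $X_t^x=x+B_t-\Lambda_t$ and $\tau^x=\inf\{t\ge0:X_t^x\le0\}$, one has $\Lambda_t=\int_0^\infty\mathbb{P}(\tau^x\le t)g(x)\,dx$ for all $t\ge0$. It is physical if for all $t\ge0$ $$\Delta\Lambda_t=\Lambda_t-\Lambda_{t^-}=\inf\Big\{x>0:\int_0^\infty\mathbb{P}(X_{t^-}^y\in[0,x],\ \tau^y\ge t)g(y)\,dy<x\Big\},\qquad X_{t^-}^y=y+B_t-\Lambda_{t^-}.$$ *)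

theory Defs
  imports "HOL-Probability.Probability"
begin

locale standard_brownian_motion = prob_space M for M :: "'a measure" +
  fixes B :: "real \<Rightarrow> 'a \<Rightarrow> real"
  assumes random_variable: "\<And>t. 0 \<le> t \<Longrightarrow> B t \<in> borel_measurable M"
    and start_zero: "\<And>\<omega>. \<omega> \<in> space M \<Longrightarrow> B 0 \<omega> = 0"
    and continuous_paths: "\<And>\<omega>. \<omega> \<in> space M \<Longrightarrow> continuous_on {0..} (\<lambda>t. B t \<omega>)"
    and normal_increments: "\<And>s t. 0 \<le> s \<Longrightarrow> s < t \<Longrightarrow>
      distributed M lborel (\<lambda>\<omega>. B t \<omega> - B s \<omega>) (normal_density 0 (sqrt (t - s)))"
    and independent_increments: "\<And>(u :: nat \<Rightarrow> real) n. 0 \<le> u 0 \<Longrightarrow> mono u \<Longrightarrow>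
      indep_vars (\<lambda>_. borel) (\<lambda>i \<omega>. B (u (Suc i)) \<omega> - B (u i) \<omega>) {..<n}"

text \<open>Functions on \<open>[0, \<infinity>)\<close> are represented by functions on the reals whose values at negative
  arguments are irrelevant; the convention \<open>\<Lambda>\<^bsub>0-\<^esub> = 0\<close> is built into the left limit.\<close>

definition left_limit :: "(real \<Rightarrow> real) \<Rightarrow> real \<Rightarrow> real" where
  "left_limit \<Lambda> t = (if t \<le> 0 then 0 else Lim (at_left t) \<Lambda>)"

definition jump :: "(real \<Rightarrow> real) \<Rightarrow> real \<Rightarrow> real" where
  "jump \<Lambda> t = \<Lambda> t - left_limit \<Lambda> t"

definition cadlag :: "(real \<Rightarrow> real) \<Rightarrow> bool" where
  "cadlag \<Lambda> \<longleftrightarrow> (\<forall>t\<ge>0. (\<Lambda> \<longlongrightarrow> \<Lambda> t) (at_right t)) \<and> (\<forall>t>0. \<exists>l. (\<Lambda> \<longlongrightarrow> l) (at_left t))"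

definition X :: "(real \<Rightarrow> 'a \<Rightarrow> real) \<Rightarrow> (real \<Rightarrow> real) \<Rightarrow> real \<Rightarrow> real \<Rightarrow> 'a \<Rightarrow> real" where
  "X B \<Lambda> x t \<omega> = x + B t \<omega> - \<Lambda> t"

definition X_left :: "(real \<Rightarrow> 'a \<Rightarrow> real) \<Rightarrow> (real \<Rightarrow> real) \<Rightarrow> real \<Rightarrow> real \<Rightarrow> 'a \<Rightarrow> real" where
  "X_left B \<Lambda> x t \<omega> = x + B t \<omega> - left_limit \<Lambda> t"

text \<open>Extended reals, so that the hitting time of a path that never reaches \<open>(-\<infinity>, 0]\<close>
  is \<open>\<infinity>\<close>.\<close>

definition hitting_time ::
    "(real \<Rightarrow> 'a \<Rightarrow> real) \<Rightarrow> (real \<Rightarrow> real) \<Rightarrow> real \<Rightarrow> 'a \<Rightarrow> ereal" where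
  "hitting_time B \<Lambda> x \<omega> = Inf {ereal t | t. 0 \<le> t \<and> X B \<Lambda> x t \<omega> \<le> 0}"

text \<open>The density \<open>g\<close> need not be integrable, hence the integrals are taken in \<open>[0, \<infinity>]\<close>. In
  particular the equation below asserts that its right-hand side is finite.\<close>

definition mckean_vlasov_solution ::
    "'a measure \<Rightarrow> (real \<Rightarrow> 'a \<Rightarrow> real) \<Rightarrow> (real \<Rightarrow> real) \<Rightarrow> (real \<Rightarrow> real) \<Rightarrow> bool" where
  "mckean_vlasov_solution M B g \<Lambda> \<longleftrightarrow>
     (\<forall>t\<ge>0. 0 \<le> \<Lambda> t) \<and> mono_on {0..} \<Lambda> \<and> cadlag \<Lambda> \<and>
     (\<forall>t\<ge>0. ennreal (\<Lambda> t) =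
        (\<integral>\<^sup>+x\<in>{0..}. ennreal (measure M {\<omega> \<in> space M. hitting_time B \<Lambda> x \<omega> \<le> ereal t} * g x)
           \<partial>lborel))"

text \<open>The infimum is taken in the extended reals, so that it is \<open>\<infinity>\<close> for the empty set.\<close>

definition physical_solution ::
    "'a measure \<Rightarrow> (real \<Rightarrow> 'a \<Rightarrow> real) \<Rightarrow> (real \<Rightarrow> real) \<Rightarrow> (real \<Rightarrow> real) \<Rightarrow> bool" where
  "physical_solution M B g \<Lambda> \<longleftrightarrow>
     mckean_vlasov_solution M B g \<Lambda> \<and>
     (\<forall>t\<ge>0. ereal (jump \<Lambda> t) =
        Inf {ereal x | x. 0 < x \<and>
          (\<integral>\<^sup>+y\<in>{0..}. ennreal (measure M {\<omega> \<in> space M.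
               X_left B \<Lambda> y t \<omega> \<in> {0..x} \<and> ereal t \<le> hitting_time B \<Lambda> y \<omega>} * g y)
             \<partial>lborel) < ennreal x})"

definition x_hat :: "real \<Rightarrow> int \<Rightarrow> real" where
  "x_hat L i = (if i < 0 then 0 else \<Sum>j\<le>nat i. L ^ j)"

text \<open>The values at the common endpoints of the intervals are immaterial; here they are \<open>0\<close>.\<close>

definition h :: "real \<Rightarrow> real \<Rightarrow> real \<Rightarrow> real" where
  "h L \<alpha> x =
     (if x \<in> (\<Union>i::nat. {x_hat L (2 * int i - 1)..x_hat L (2 * int i)}) then 0
      else if x \<in> (\<Union>i::nat. {x_hat L (2 * int i)..x_hat L (2 * int i + 1)}) then (1 - \<alpha>) * L
      else 0)"

lemma x_hat_minus_one: "x_hat L (- 1) = 0"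
  by (simp add: x_hat_def)

lemma x_hat_closed_form: "L \<noteq> 1 \<Longrightarrow> x_hat L (int i) = (L ^ (i + 1) - 1) / (L - 1)"
  using geometric_sum[of L "Suc i"] by (simp add: x_hat_def lessThan_Suc_atMost)

end

theory Submission
  imports Defs
begin

text \<open>
  Let \<open>\<nu>\<close> have density \<open>g\<close> on \<open>[0, \<infinity>)\<close>. The map sending a front \<open>\<Phi>\<close> to the mass it has absorbed
  before each time is monotone, so it has a least fixed point. It is finite because a front that jumps at
  once to a level \<open>R\<close> with \<open>\<nu> {..R}\<close> well below \<open>R\<close> absorbs less than \<open>R\<close> up to any given time, by
  Levy's maximal inequality. The right-continuous version of the fixed point solves the McKean--Vlasov
  equation. Its jumps are not larger than the physical ones, since stopping the front earlier would
  give a smaller supersolution. They are not smaller either: otherwise, right after the jump, the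
  mass just ahead of the front has density at least \<open>1\<close> on average, and Brownian fluctuations then
  push the front further than it actually moves.

  Finally, at time \<open>t\<close> all paths that start below \<open>\<Lambda>\<^sub>t\<close> and satisfy \<open>B\<^sub>t \<le> 0\<close> are dead, whence
  \<open>\<nu> {..\<Lambda>\<^sub>t} \<le> 2 \<Lambda>\<^sub>t\<close>. So the unbounded function \<open>\<Lambda>\<close> never takes a value \<open>R\<close> with \<open>\<nu> {..R} > 2 R\<close>,
  such as the right end of a layer of \<open>h\<close>, and has to jump across it.
\<close>

section \<open>Brownian motion\<close>

text \<open>Independence makes the joint law a product measure, so Fubini allows the second
  component to be frozen at an independent outcome. This replaces conditioning on a future
  increment.\<close>

lemma (in prob_space) emeasure_indep_pair:
  assumes ind: "indep_var S V T N" and Q: "Q \<in> sets (S \<Otimes>\<^sub>M T)"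
  shows "emeasure M {\<omega> \<in> space M. (V \<omega>, N \<omega>) \<in> Q}
    = (\<integral>\<^sup>+\<omega>'. emeasure M {\<omega> \<in> space M. (V \<omega>, N \<omega>') \<in> Q} \<partial>M)"
proof -
  have V[measurable]: "random_variable S V" and N[measurable]: "random_variable T N"
    using ind by (auto dest: indep_var_rv1 indep_var_rv2)
  interpret SV: prob_space "distr M S V" by (rule prob_space_distr) simp
  interpret TN: prob_space "distr M T N" by (rule prob_space_distr) simp
  interpret P: pair_sigma_finite "distr M S V" "distr M T N" ..
  have Q': "Q \<in> sets (distr M S V \<Otimes>\<^sub>M distr M T N)"
    using Q by (simp cong: sets_pair_measure_cong)
  have sect: "(\<lambda>x. (x, y)) -` Q \<in> sets S" for y
    using Q by (rule sets_Pair2)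
  have "emeasure M {\<omega> \<in> space M. (V \<omega>, N \<omega>) \<in> Q} = emeasure (distr M (S \<Otimes>\<^sub>M T) (\<lambda>\<omega>. (V \<omega>, N \<omega>))) Q"
    using Q by (subst emeasure_distr) (auto intro!: arg_cong[where f="emeasure M"])
  also have "\<dots> = emeasure (distr M S V \<Otimes>\<^sub>M distr M T N) Q"
    using ind by (simp add: indep_var_distribution_eq)
  also have "\<dots> = (\<integral>\<^sup>+y. emeasure (distr M S V) ((\<lambda>x. (x, y)) -` Q) \<partial>distr M T N)"
    using Q' by (rule P.emeasure_pair_measure_alt2)
  also have "\<dots> = (\<integral>\<^sup>+\<omega>'. emeasure (distr M S V) ((\<lambda>x. (x, N \<omega>')) -` Q) \<partial>M)"
    using P.measurable_emeasure_Pair2[OF Q'] by (intro nn_integral_distr) (auto simp: measurable_distr_eq1)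
  also have "\<dots> = (\<integral>\<^sup>+\<omega>'. emeasure M {\<omega> \<in> space M. (V \<omega>, N \<omega>') \<in> Q} \<partial>M)"
    using sect by (intro nn_integral_cong, subst emeasure_distr)
      (auto intro!: arg_cong[where f="emeasure M"])
  finally show ?thesis .
qed

context standard_brownian_motion
begin

lemma B_measurable[measurable]: "0 \<le> t \<Longrightarrow> B t \<in> borel_measurable M"
  by (rule random_variable)

text \<open>Only consecutive increments are assumed independent, and positions on the grid are
  partial sums of them. The remaining increment is wrapped as a function on the index set
  \<open>{n}\<close> because \<open>indep_var_restrict\<close> yields product spaces.\<close>

lemma indep_past_increment:
  fixes u :: "nat \<Rightarrow> real"
  assumes u: "mono u" "0 \<le> u 0" and v: "u n \<le> v"
  shows "indep_var (PiM {..n} (\<lambda>_. borel)) (\<lambda>\<omega>. \<lambda>k\<in>{..n}. B (u k) \<omega> - B (u 0) \<omega>)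
    (PiM {n} (\<lambda>_. borel)) (\<lambda>\<omega>. \<lambda>k\<in>{n}. B v \<omega> - B (u n) \<omega>)"
proof -
  \<comment> \<open>Continuing the grid with the constant value \<open>v\<close> after index
    \<open>n\<close> turns the later increment into the \<open>n\<close>-th increment of a single
    monotone sequence.\<close>
  define w :: "nat \<Rightarrow> real" where "w = (\<lambda>i. if i \<le> n then u i else v)"
  define I where "I = (\<lambda>i \<omega>. B (w (Suc i)) \<omega> - B (w i) \<omega>)"
  have "mono w"
    using u v by (auto simp: mono_def w_def intro: order.trans[of _ "u n"])
  then have "indep_vars (\<lambda>_. borel) I {..<Suc n}"
    unfolding I_def using u by (intro independent_increments) (auto simp: w_def)
  then have "indep_var (PiM {..<n} (\<lambda>_. borel)) (\<lambda>\<omega>. restrict (\<lambda>i. I i \<omega>) {..<n})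
      (PiM {n} (\<lambda>_. borel)) (\<lambda>\<omega>. restrict (\<lambda>i. I i \<omega>) {n})"
    by (rule indep_var_restrict) auto
  then have "indep_var (PiM {..n} (\<lambda>_. borel)) ((\<lambda>f. \<lambda>k\<in>{..n}. \<Sum>i<k. f i :: real) \<circ> (\<lambda>\<omega>. restrict (\<lambda>i. I i \<omega>) {..<n}))
      (PiM {n} (\<lambda>_. borel)) ((\<lambda>f. f) \<circ> (\<lambda>\<omega>. restrict (\<lambda>i. I i \<omega>) {n}))"
    by (rule indep_var_compose)
       (auto intro!: measurable_restrict borel_measurable_sum measurable_component_singleton)
  also have "(\<lambda>f. \<lambda>k\<in>{..n}. \<Sum>i<k. f i :: real) \<circ> (\<lambda>\<omega>. restrict (\<lambda>i. I i \<omega>) {..<n})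
      = (\<lambda>\<omega>. \<lambda>k\<in>{..n}. B (u k) \<omega> - B (u 0) \<omega>)"
  proof (intro ext)
    fix \<omega> k
    have "(\<Sum>i<k. if i < n then I i \<omega> else undefined) = (\<Sum>i<k. I i \<omega>)" if "k \<le> n"
      using that by (intro sum.cong) auto
    moreover have "(\<Sum>i<k. I i \<omega>) = B (w k) \<omega> - B (w 0) \<omega>"
      unfolding I_def by (rule sum_lessThan_telescope)
    ultimately show "((\<lambda>f. \<lambda>k\<in>{..n}. \<Sum>i<k. f i :: real) \<circ> (\<lambda>\<omega>. restrict (\<lambda>i. I i \<omega>) {..<n})) \<omega> k
      = (\<lambda>k\<in>{..n}. B (u k) \<omega> - B (u 0) \<omega>) k"
      by (auto simp: w_def restrict_def)
  qed
  also have "(\<lambda>f. f) \<circ> (\<lambda>\<omega>. restrict (\<lambda>i. I i \<omega>) {n}) = (\<lambda>\<omega>. \<lambda>k\<in>{n}. B v \<omega> - B (u n) \<omega>)"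
    by (auto simp: I_def w_def fun_eq_iff)
  finally show ?thesis .
qed

section \<open>Symmetry and tails of increments\<close>

lemma distr_increment_symmetric:
  assumes "0 \<le> s" "s \<le> t"
  shows "distr M borel (\<lambda>\<omega>. B s \<omega> - B t \<omega>) = distr M borel (\<lambda>\<omega>. B t \<omega> - B s \<omega>)"
proof (cases "s = t")
  case False
  then have st: "s < t" using assms by simp
  have D: "distributed M lborel (\<lambda>\<omega>. B t \<omega> - B s \<omega>) (normal_density 0 (sqrt (t - s)))"
    by (rule normal_increments[OF assms(1) st])
  then have "distributed M lborel (\<lambda>\<omega>. 0 + (-1) * (B t \<omega> - B s \<omega>)) (normal_density (0 + (-1) * 0) (\<bar>-1\<bar> * sqrt (t - s)))"
    using st by (intro normal_density_affine) auto
  then have D': "distributed M lborel (\<lambda>\<omega>. B s \<omega> - B t \<omega>) (normal_density 0 (sqrt (t - s)))"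
    by simp
  have "distr M borel X = distr M lborel X" for X :: "'a \<Rightarrow> real"
    by (rule distr_cong) auto
  with distributed_distr_eq_density[OF D] distributed_distr_eq_density[OF D'] show ?thesis
    by simp
qed simp

text \<open>By symmetry the increment is as likely to be nonpositive as nonnegative, and the two
  events cover the space.\<close>

lemma prob_increment_nonpos_ge_half:
  assumes "0 \<le> s" "s \<le> t"
  shows "1 / 2 \<le> prob {\<omega> \<in> space M. B t \<omega> - B s \<omega> \<le> 0}"
proof -
  have [measurable]: "B s \<in> borel_measurable M" "B t \<in> borel_measurable M" using assms by auto
  have "prob {\<omega> \<in> space M. B s \<omega> - B t \<omega> \<le> 0} = measure (distr M borel (\<lambda>\<omega>. B s \<omega> - B t \<omega>)) {..0}"
    by (subst measure_distr) (auto intro!: arg_cong[where f=prob])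
  also have "\<dots> = prob {\<omega> \<in> space M. B t \<omega> - B s \<omega> \<le> 0}"
    unfolding distr_increment_symmetric[OF assms]
    by (subst measure_distr) (auto intro!: arg_cong[where f=prob])
  finally have *: "prob {\<omega> \<in> space M. B s \<omega> - B t \<omega> \<le> 0} = prob {\<omega> \<in> space M. B t \<omega> - B s \<omega> \<le> 0}" .
  have "1 = prob ({\<omega> \<in> space M. B t \<omega> - B s \<omega> \<le> 0} \<union> {\<omega> \<in> space M. B s \<omega> - B t \<omega> \<le> 0})"
    by (subst prob_space[symmetric]) (auto intro!: arg_cong[where f=prob])
  also have "\<dots> \<le> prob {\<omega> \<in> space M. B t \<omega> - B s \<omega> \<le> 0} + prob {\<omega> \<in> space M. B s \<omega> - B t \<omega> \<le> 0}"
    by (rule measure_Un_le) auto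
  finally show ?thesis using * by simp
qed

lemma prob_le_zero_ge_half: "0 \<le> t \<Longrightarrow> 1 / 2 \<le> prob {\<omega> \<in> space M. B t \<omega> \<le> 0}"
proof -
  assume "0 \<le> t"
  then have "1 / 2 \<le> prob {\<omega> \<in> space M. B t \<omega> - B 0 \<omega> \<le> 0}"
    by (intro prob_increment_nonpos_ge_half) auto
  also have "{\<omega> \<in> space M. B t \<omega> - B 0 \<omega> \<le> 0} = {\<omega> \<in> space M. B t \<omega> \<le> 0}"
    using start_zero by auto
  finally show ?thesis .
qed

lemma distributed_B: "0 < t \<Longrightarrow> distributed M lborel (B t) (normal_density 0 (sqrt t))"
proof -
  assume t: "0 < t"
  have "distr M lborel (\<lambda>\<omega>. B t \<omega> - B 0 \<omega>) = distr M lborel (B t)"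
    using start_zero by (intro distr_cong) auto
  with normal_increments[of 0 t] t show ?thesis
    by (auto simp: distributed_def)
qed

lemma integrable_B: "0 < t \<Longrightarrow> integrable M (B t)"
proof -
  assume t: "0 < t"
  then have "integrable lborel (\<lambda>x. normal_density 0 (sqrt t) x * x)"
    by (intro integrable_normal_moment_nz_1) auto
  then show ?thesis
    using distributed_integrable[OF distributed_B[OF t], of "\<lambda>x. x"] by simp
qed

text \<open>The normal density is at most \<open>1 / sqrt t\<close>, so the values in
  \<open>(-K, 0]\<close> carry probability at most \<open>K / sqrt t\<close>, hence at most 1/4,
  while the nonpositive values carry at least 1/2.\<close>

lemma prob_le_ge_quarter:
  assumes K: "0 \<le> K" and t: "0 < t" "4 * K \<le> sqrt t"
  shows "1 / 4 \<le> prob {\<omega> \<in> space M. B t \<omega> \<le> - K}"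
proof -
  have [measurable]: "B t \<in> borel_measurable M" using t by auto
  have dens: "normal_density 0 (sqrt t) x \<le> 1 / sqrt t" for x
  proof -
    have "1 * sqrt t \<le> sqrt (2 * pi) * sqrt t"
      using pi_gt3 t by (intro mult_right_mono) auto
    then have "1 / sqrt (2 * pi * t) \<le> 1 / sqrt t"
      using t by (intro divide_left_mono) (auto simp: real_sqrt_mult)
    moreover have "exp (- x\<^sup>2 / (2 * t)) \<le> 1" using t by simp
    ultimately have "1 / sqrt (2 * pi * t) * exp (- x\<^sup>2 / (2 * t)) \<le> 1 / sqrt t * 1"
      by (intro mult_mono) (use t in auto)
    then show ?thesis using t by (simp add: normal_density_def)
  qed
  have "emeasure M (B t -` {-K<..0} \<inter> space M) = (\<integral>\<^sup>+x. ennreal (normal_density 0 (sqrt t) x) * indicator {-K<..0} x \<partial>lborel)"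
    by (rule distributed_emeasure[OF distributed_B[OF t(1)]]) auto
  also have "\<dots> \<le> (\<integral>\<^sup>+x. ennreal (1 / sqrt t) * indicator {-K<..0} x \<partial>lborel)"
    using dens by (intro nn_integral_mono mult_right_mono ennreal_leI) auto
  also have "\<dots> = ennreal (K / sqrt t)"
    using K t by (simp add: nn_integral_cmult_indicator ennreal_mult[symmetric] del: ennreal_mult')
  also have "\<dots> \<le> ennreal (1 / 4)"
    using t by (intro ennreal_leI) (auto simp: field_simps)
  finally have "prob (B t -` {-K<..0} \<inter> space M) \<le> 1 / 4"
    by (simp add: emeasure_eq_measure del: ennreal_numeral)
  moreover have "prob {\<omega> \<in> space M. B t \<omega> \<le> 0}
    \<le> prob {\<omega> \<in> space M. B t \<omega> \<le> - K} + prob (B t -` {-K<..0} \<inter> space M)"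
    by (rule order.trans[OF finite_measure_mono measure_Un_le]) auto
  ultimately show ?thesis using prob_le_zero_ge_half[of t] t by simp
qed

text \<open>A path below \<open>c\<close> at its first passage stays below \<open>c\<close> at the final time with conditional
  probability at least one half, by symmetry of the remaining increment.\<close>

lemma prob_grid_below_le:
  fixes u :: "nat \<Rightarrow> real"
  assumes u: "mono u" "u 0 = 0"
  shows "prob {\<omega> \<in> space M. \<exists>k\<le>n. B (u k) \<omega> < c} \<le> 2 * prob {\<omega> \<in> space M. B (u n) \<omega> < c}"
proof -
  have u0: "0 \<le> u k" for k using u monoD[OF u(1), of 0 k] by simp
  have [measurable]: "B (u k) \<in> borel_measurable M" for k using u0 by auto
  \<comment> \<open>\<open>A k\<close> is the first passage below \<open>c\<close> at index
    \<open>k\<close>, and \<open>E k\<close> says that the rest of the path does not end higher. On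
    their intersection the path ends below \<open>c\<close>.\<close>
  define A where "A k = {\<omega> \<in> space M. B (u k) \<omega> < c \<and> (\<forall>j<k. c \<le> B (u j) \<omega>)}" for k
  define E where "E k = {\<omega> \<in> space M. B (u n) \<omega> - B (u k) \<omega> \<le> 0}" for k
  have A[measurable]: "A k \<in> sets M" and E[measurable]: "E k \<in> sets M" for k
    unfolding A_def E_def by measurable
  have disj: "disjoint_family_on A {..n}"
    by (auto simp: disjoint_family_on_def A_def) (metis linorder_neqE_nat not_le)
  have half: "prob (A k) \<le> 2 * prob (A k \<inter> E k)" if "k \<le> n" for k
  proof -
    define Q where "Q = {f \<in> space (PiM {..k} (\<lambda>_. borel :: real measure)). f k < c \<and> (\<forall>j\<in>{..<k}. c \<le> f j)}"
    have Q: "Q \<in> sets (PiM {..k} (\<lambda>_. borel))"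
      unfolding Q_def by measurable
    define R where "R = {f \<in> space (PiM {k} (\<lambda>_. borel :: real measure)). f k \<le> 0}"
    have R: "R \<in> sets (PiM {k} (\<lambda>_. borel))"
      unfolding R_def by measurable
    have eqR: "(\<lambda>\<omega>. \<lambda>i\<in>{k}. B (u n) \<omega> - B (u k) \<omega>) -` R \<inter> space M = E k"
      by (auto simp: R_def E_def space_PiM)
    have eq: "(\<lambda>\<omega>. \<lambda>i\<in>{..k}. B (u i) \<omega> - B (u 0) \<omega>) -` Q \<inter> space M = A k"
      using start_zero u(2) by (auto simp: Q_def A_def space_PiM)
    have iv: "indep_var (PiM {..k} (\<lambda>_. borel)) (\<lambda>\<omega>. \<lambda>i\<in>{..k}. B (u i) \<omega> - B (u 0) \<omega>)
        (PiM {k} (\<lambda>_. borel)) (\<lambda>\<omega>. \<lambda>i\<in>{k}. B (u n) \<omega> - B (u k) \<omega>)"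
      using u that by (intro indep_past_increment) (auto dest: monoD)
    have "prob (A k \<inter> E k) = prob ((\<lambda>\<omega>. (\<lambda>i\<in>{..k}. B (u i) \<omega> - B (u 0) \<omega>,
        \<lambda>i\<in>{k}. B (u n) \<omega> - B (u k) \<omega>)) -` (Q \<times> R) \<inter> space M)"
      unfolding eq[symmetric] eqR[symmetric] by (intro arg_cong[where f=prob]) auto
    also have "\<dots> = prob (A k) * prob (E k)"
      unfolding indep_varD[OF iv Q R] eq eqR ..
    finally have "prob (A k \<inter> E k) = prob (A k) * prob (E k)" .
    moreover have "1 / 2 \<le> prob (E k)"
      unfolding E_def using u u0 that by (intro prob_increment_nonpos_ge_half) (auto dest: monoD)
    then have "prob (A k) * (1 / 2) \<le> prob (A k) * prob (E k)"
      by (intro mult_left_mono) auto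
    ultimately show ?thesis by simp
  qed
  have "{\<omega> \<in> space M. \<exists>k\<le>n. B (u k) \<omega> < c} \<subseteq> (\<Union>k\<in>{..n}. A k)"
  proof safe
    fix \<omega> k assume \<omega>: "\<omega> \<in> space M" "k \<le> n" "B (u k) \<omega> < c"
    define j where "j = (LEAST k. B (u k) \<omega> < c)"
    have "B (u j) \<omega> < c" "j \<le> k" "\<And>i. i < j \<Longrightarrow> \<not> B (u i) \<omega> < c"
      unfolding j_def using \<omega>(3) by (auto intro: LeastI Least_le dest: not_less_Least)
    then show "\<omega> \<in> (\<Union>k\<in>{..n}. A k)"
      using \<omega> by (auto simp: A_def not_less intro!: bexI[of _ j])
  qed
  then have "prob {\<omega> \<in> space M. \<exists>k\<le>n. B (u k) \<omega> < c} \<le> prob (\<Union>k\<in>{..n}. A k)"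
    by (intro finite_measure_mono) auto
  also have "\<dots> = (\<Sum>k\<le>n. prob (A k))"
    using disj by (intro finite_measure_finite_Union) auto
  also have "\<dots> \<le> (\<Sum>k\<le>n. 2 * prob (A k \<inter> E k))"
    using half by (intro sum_mono) auto
  also have "\<dots> = 2 * prob (\<Union>k\<in>{..n}. A k \<inter> E k)"
    using disj by (subst finite_measure_finite_Union)
      (auto simp: sum_distrib_left disjoint_family_on_def)
  also have "\<dots> \<le> 2 * prob {\<omega> \<in> space M. B (u n) \<omega> < c}"
    by (intro mult_left_mono finite_measure_mono) (auto simp: A_def E_def)
  finally show ?thesis .
qed

end

text \<open>Approximation from below suits strict inequalities against a left-continuous front.
  Dyadic grids are nested, which makes the associated events increasing.\<close>

lemma dyadic_approx_below:
  fixes s t e :: real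
  assumes "0 \<le> s" "s < t" "0 < e"
  obtains m k where "k \<le> 2 ^ m" "s - e < t * real k / 2 ^ m" "t * real k / 2 ^ m \<le> s"
proof -
  obtain m where m: "(1 / 2) ^ m < e / t"
    using real_arch_pow_inv[of "e / t" "1 / 2"] assms by auto
  define k where "k = nat \<lfloor>s * 2 ^ m / t\<rfloor>"
  have "0 \<le> s * 2 ^ m / t" using assms by simp
  then have k: "real k \<le> s * 2 ^ m / t" "s * 2 ^ m / t < real k + 1"
    unfolding k_def by linarith+
  have t: "0 < t" using assms by simp
  have le: "t * real k / 2 ^ m \<le> s" using k(1) t by (simp add: field_simps)
  have "s < t * real k / 2 ^ m + t * (1 / 2) ^ m"
    using k(2) t by (simp add: field_simps power_divide)
  moreover have "t * (1 / 2) ^ m < e" using m t by (simp add: field_simps)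
  ultimately have lt: "s - e < t * real k / 2 ^ m" by simp
  have "real k < 2 ^ m"
    using assms t by (intro le_less_trans[OF k(1)]) (simp add: divide_less_eq)
  then have "k \<le> 2 ^ m" using of_nat_less_iff[of k "2 ^ m", where ?'a = real] by simp
  then show ?thesis using le lt that by blast
qed

section \<open>Maximal inequality in continuous time\<close>

context standard_brownian_motion
begin

lemma continuous_B:
  assumes "\<omega> \<in> space M" "0 \<le> s" "0 < e"
  obtains d where "0 < d" "\<And>r. 0 \<le> r \<Longrightarrow> \<bar>r - s\<bar> < d \<Longrightarrow> \<bar>B r \<omega> - B s \<omega>\<bar> < e"
proof -
  have "\<exists>d>0. \<forall>r\<in>{0..}. dist r s < d \<longrightarrow> dist (B r \<omega>) (B s \<omega>) < e"
    using continuous_paths[OF assms(1)] assms(2,3) unfolding continuous_on_iff by auto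
  then show ?thesis using that unfolding dist_real_def by auto
qed

text \<open>Path continuity turns a passage at any time into a passage on a fine dyadic grid. The
  grid events increase, so the bound for each grid passes to the limit.\<close>

lemma prob_running_min_le:
  assumes t: "0 < t"
  shows "prob {\<omega> \<in> space M. \<exists>s\<in>\<rat>. 0 \<le> s \<and> s < t \<and> B s \<omega> < c} \<le> 2 * prob {\<omega> \<in> space M. B t \<omega> < c}"
proof -
  define A where "A m = {\<omega> \<in> space M. \<exists>k\<in>{..2 ^ m}. B (t * real k / 2 ^ m) \<omega> < c}" for m
  have A[measurable]: "A m \<in> sets M" for m
  proof -
    have [measurable]: "B (t * real k / 2 ^ m) \<in> borel_measurable M" for k using t by auto
    show ?thesis unfolding A_def by measurable
  qed
  have sub: "{\<omega> \<in> space M. \<exists>s\<in>\<rat>. 0 \<le> s \<and> s < t \<and> B s \<omega> < c} \<subseteq> (\<Union>m. A m)"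
  proof safe
    fix \<omega> s assume \<omega>: "\<omega> \<in> space M" and s: "0 \<le> s" "s < t" "B s \<omega> < c"
    obtain d where d: "0 < d" "\<And>r. 0 \<le> r \<Longrightarrow> \<bar>r - s\<bar> < d \<Longrightarrow> \<bar>B r \<omega> - B s \<omega>\<bar> < c - B s \<omega>"
      using continuous_B[OF \<omega> s(1), of "c - B s \<omega>"] s(3) by auto
    obtain m k where mk: "k \<le> 2 ^ m" "s - d < t * real k / 2 ^ m" "t * real k / 2 ^ m \<le> s"
      using dyadic_approx_below[OF s(1,2) d(1)] .
    have "B (t * real k / 2 ^ m) \<omega> < c"
      using d(2)[of "t * real k / 2 ^ m"] mk t by auto
    then show "\<omega> \<in> (\<Union>m. A m)" using \<omega> mk(1) by (auto simp: A_def)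
  qed
  have "incseq A"
  proof (rule incseq_SucI, safe)
    fix m \<omega> assume "\<omega> \<in> A m"
    then obtain k where k: "\<omega> \<in> space M" "k \<le> 2 ^ m" "B (t * real k / 2 ^ m) \<omega> < c" by (auto simp: A_def)
    then show "\<omega> \<in> A (Suc m)" by (auto simp: A_def intro!: bexI[of _ "2 * k"])
  qed
  then have "(\<lambda>m. prob (A m)) \<longlonglongrightarrow> prob (\<Union>m. A m)"
    by (intro finite_Lim_measure_incseq) auto
  moreover have "prob (A m) \<le> 2 * prob {\<omega> \<in> space M. B t \<omega> < c}" for m
    using prob_grid_below_le[of "\<lambda>k. t * real k / 2 ^ m" "2 ^ m" c] t
    by (simp add: A_def mono_def divide_right_mono Bex_def)
  ultimately have "prob (\<Union>m. A m) \<le> 2 * prob {\<omega> \<in> space M. B t \<omega> < c}"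
    by (intro LIMSEQ_le_const2) auto
  then show ?thesis
    using finite_measure_mono[OF sub] by auto
qed

end

section \<open>The minimal solution\<close>

text \<open>The cutoff by the indicator makes the values of \<open>g\<close> at negative arguments
  immaterial. The total mass may be infinite.\<close>

definition initial_law :: "(real \<Rightarrow> real) \<Rightarrow> real measure" where
  "initial_law g = density lborel (\<lambda>x. ennreal (g x) * indicator {0..} x)"

lemma emeasure_initial_law_neg:
  assumes [measurable]: "g \<in> borel_measurable borel"
  shows "emeasure (initial_law g) {..<0} = 0"
proof -
  have "emeasure (initial_law g) {..<0} = (\<integral>\<^sup>+x. 0 \<partial>(lborel :: real measure))"
    unfolding initial_law_def
    by (subst emeasure_density, simp, simp, rule nn_integral_cong) (simp add: indicator_def)
  then show ?thesis by simp
qed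

lemma sets_ex_rat:
  fixes Q :: "real \<Rightarrow> bool"
  assumes "\<And>s. s \<in> \<rat> \<Longrightarrow> Q s \<Longrightarrow> {p \<in> space N. R s p} \<in> sets N"
  shows "{p \<in> space N. \<exists>s\<in>\<rat>. Q s \<and> R s p} \<in> sets N"
proof -
  have "{p \<in> space N. \<exists>s\<in>\<rat>. Q s \<and> R s p} = (\<Union>s\<in>{s\<in>\<rat>. Q s}. {p \<in> space N. R s p})"
    by auto
  also have "\<dots> \<in> sets N"
    using assms by (intro sets.countable_UN'') (auto intro: countable_subset[OF _ countable_rat])
  finally show ?thesis .
qed

text \<open>\<open>subcritical\<close> provides arbitrarily large levels \<open>R\<close> below
  which the mass falls short of \<open>R\<close> by any prescribed amount. Such levels act as
  barriers and keep the loss finite; the bound \<open>C\<close> controls the mass that starts beyond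
  a barrier.\<close>

locale stefan_problem = standard_brownian_motion M B
  for M :: "'a measure" and B :: "real \<Rightarrow> 'a \<Rightarrow> real" +
  fixes g :: "real \<Rightarrow> real" and C :: real
  assumes g_measurable[measurable]: "g \<in> borel_measurable borel"
    and g_nonneg: "0 \<le> g x"
    and g_le: "g x \<le> C"
    and subcritical: "\<exists>R\<ge>K. emeasure (initial_law g) {..R} \<le> ennreal (R - K)"
begin

abbreviation "\<nu> \<equiv> initial_law g"
abbreviation "\<mu> \<equiv> \<nu> \<Otimes>\<^sub>M M"

lemma C_nonneg: "0 \<le> C"
  using g_nonneg[of 0] g_le[of 0] by simp

lemma sets_\<nu>[measurable_cong]: "sets \<nu> = sets borel" and space_\<nu>: "space \<nu> = UNIV"
  by (simp_all add: initial_law_def)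

lemma nn_integral_\<nu>:
  "f \<in> borel_measurable borel \<Longrightarrow>
    (\<integral>\<^sup>+x. f x \<partial>\<nu>) = (\<integral>\<^sup>+x. ennreal (g x) * indicator {0..} x * f x \<partial>lborel)"
  unfolding initial_law_def by (subst nn_integral_density) auto

lemma sigma_finite_\<nu>: "sigma_finite_measure \<nu>"
  unfolding initial_law_def
  by (subst sigma_finite_measure.sigma_finite_iff_density_finite[OF sigma_finite_lborel])
    (auto simp: indicator_def ennreal_mult_eq_top_iff intro!: AE_I2)

sublocale P: pair_sigma_finite \<nu> M
  using sigma_finite_\<nu> by (intro pair_sigma_finite.intro) (simp_all add: sigma_finite_measure_axioms)

lemma space_\<mu>: "space \<mu> = UNIV \<times> space M"
  by (simp add: space_pair_measure space_\<nu>)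

lemma fst_\<mu>[measurable]: "fst \<in> borel_measurable \<mu>"
  using measurable_fst[of \<nu> M] by (simp cong: measurable_cong_sets)

lemma B_snd[measurable]: "0 \<le> s \<Longrightarrow> (\<lambda>p. B s (snd p)) \<in> borel_measurable \<mu>"
  by measurable

text \<open>A measure with a density has no atoms, so Fubini applies. The lemma absorbs the
  differences between strict and weak inequalities, which concern at most one start per
  outcome.\<close>

lemma null_if_one_point_sections:
  assumes A: "A \<in> sets \<mu>" and one: "\<And>\<omega> x y. (x, \<omega>) \<in> A \<Longrightarrow> (y, \<omega>) \<in> A \<Longrightarrow> x < y \<Longrightarrow> False"
  shows "emeasure \<mu> A = 0"
proof -
  have "emeasure \<nu> ((\<lambda>x. (x, \<omega>)) -` A) = 0" for \<omega>
  proof -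
    have "\<exists>z. (\<lambda>x. (x, \<omega>)) -` A \<subseteq> {z}"
    proof (cases "(\<lambda>x. (x, \<omega>)) -` A = {}")
      case False
      then obtain z where z: "(z, \<omega>) \<in> A" by auto
      have "x = z" if "(x, \<omega>) \<in> A" for x
        using one[OF that z] one[OF z that] by (meson linorder_cases)
      then show ?thesis by auto
    qed simp
    then obtain z where "(\<lambda>x. (x, \<omega>)) -` A \<subseteq> {z}" ..
    then have "emeasure \<nu> ((\<lambda>x. (x, \<omega>)) -` A) \<le> emeasure \<nu> {z}"
      by (rule emeasure_mono) (simp add: sets_\<nu>)
    also have "emeasure \<nu> {z} = (\<integral>\<^sup>+x. (ennreal (g x) * indicator {0..} x) * indicator {z} x \<partial>lborel)"
      unfolding initial_law_def by (subst emeasure_density) auto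
    also have "\<dots> = 0"
      by (subst nn_integral_indicator_singleton) auto
    finally show ?thesis by simp
  qed
  then show ?thesis
    using A by (simp add: P.emeasure_pair_measure_alt2)
qed

text \<open>The pairs of a starting point and an outcome that are absorbed strictly before \<open>t\<close> by a front \<open>\<Phi>\<close>.
  Because of the strict inequality \<open>s < t\<close> the mass of this set is left-continuous in \<open>t\<close>, so the
  least fixed point below is the left-continuous version of the solution.\<close>

definition dead :: "(real \<Rightarrow> ereal) \<Rightarrow> real \<Rightarrow> (real \<times> 'a) set" where
  "dead \<Phi> t = {p \<in> space \<mu>. \<exists>s\<in>\<rat>. 0 \<le> s \<and> s < t \<and> ereal (fst p + B s (snd p)) < \<Phi> s}"

lemma dead_measurable[measurable]: "dead \<Phi> t \<in> sets \<mu>"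
proof -
  have "{p \<in> space \<mu>. \<exists>s\<in>\<rat>. (0 \<le> s \<and> s < t) \<and> ereal (fst p + B s (snd p)) < \<Phi> s} \<in> sets \<mu>"
  proof (rule sets_ex_rat)
    fix s :: real assume "0 \<le> s \<and> s < t"
    then have [measurable]: "(\<lambda>p. B s (snd p)) \<in> borel_measurable \<mu>" by (intro B_snd) simp
    show "{p \<in> space \<mu>. ereal (fst p + B s (snd p)) < \<Phi> s} \<in> sets \<mu>" by measurable
  qed
  then show ?thesis by (simp add: dead_def conj_assoc)
qed

lemma dead_mono: "(\<And>s. 0 \<le> s \<Longrightarrow> s < t \<Longrightarrow> \<Phi> s \<le> \<Psi> s) \<Longrightarrow> t \<le> u \<Longrightarrow> dead \<Phi> t \<subseteq> dead \<Psi> u"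
  by (fastforce simp: dead_def intro: less_le_trans)

text \<open>Starts up to \<open>R\<close> are counted in full. A start \<open>x > R\<close> has to
  fall by \<open>x - R\<close>, which by the maximal inequality costs at most twice the probability
  at time \<open>T\<close>; integrated over \<open>x\<close> this is at most a constant.
  Subcriticality at \<open>R\<close> leaves room for that constant.\<close>

lemma barrier:
  assumes T: "0 < T"
  obtains R where "c \<le> R" "0 \<le> R" "emeasure \<mu> (dead (\<lambda>_. ereal R) T) \<le> ennreal R"
proof -
  have BT[measurable]: "B T \<in> borel_measurable M" using T by auto
  \<comment> \<open>\<open>K\<close> bounds the contribution of the starts beyond \<open>R\<close>
    uniformly in \<open>R\<close>, so it is available before \<open>R\<close> is chosen.\<close>
  define K where "K = 2 * C * (\<integral>\<omega>. \<bar>B T \<omega>\<bar> \<partial>M)"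
  have K: "0 \<le> K" unfolding K_def using C_nonneg by auto
  obtain R where R: "max (max c 0) K \<le> R" "emeasure \<nu> {..R} \<le> ennreal (R - max (max c 0) K)"
    using subcritical by metis
  interpret L: pair_sigma_finite lborel M ..
  define W where "W = {p \<in> space (lborel \<Otimes>\<^sub>M M). R < fst p \<and> B T (snd p) < R - fst p}"
  have W[measurable]: "W \<in> sets (lborel \<Otimes>\<^sub>M M)" unfolding W_def by measurable
  have sect: "emeasure M (Pair x -` dead (\<lambda>_. ereal R) T) \<le> indicator {..R} x + 2 * emeasure M (Pair x -` W)" for x
  proof (cases "x \<le> R")
    case True
    have "emeasure M (Pair x -` dead (\<lambda>_. ereal R) T) \<le> 1"
      by (rule emeasure_le_1)
    then show ?thesis using True by (auto intro: order.trans add_increasing2)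
  next
    case False
    have "Pair x -` dead (\<lambda>_. ereal R) T = {\<omega> \<in> space M. \<exists>s\<in>\<rat>. 0 \<le> s \<and> s < T \<and> B s \<omega> < R - x}"
      by (auto simp: dead_def space_\<mu> algebra_simps)
    moreover have "Pair x -` W = {\<omega> \<in> space M. B T \<omega> < R - x}"
      using False by (auto simp: W_def space_pair_measure)
    moreover have "emeasure M {\<omega> \<in> space M. \<exists>s\<in>\<rat>. 0 \<le> s \<and> s < T \<and> B s \<omega> < R - x}
        \<le> 2 * emeasure M {\<omega> \<in> space M. B T \<omega> < R - x}"
      using ennreal_leI[OF prob_running_min_le[OF T, of "R - x"]]
      by (simp add: emeasure_eq_measure ennreal_mult)
    ultimately show ?thesis using False by simp
  qed
  have "(\<integral>\<^sup>+x. emeasure M (Pair x -` W) \<partial>\<nu>) \<le> (\<integral>\<^sup>+x. C * emeasure M (Pair x -` W) \<partial>lborel)"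
    using measurable_emeasure_Pair[OF W] g_le
    by (subst nn_integral_\<nu>) (auto intro!: nn_integral_mono mult_right_mono ennreal_leI simp: indicator_def)
  also have "\<dots> = C * (\<integral>\<^sup>+x. emeasure M (Pair x -` W) \<partial>lborel)"
    using measurable_emeasure_Pair[OF W] by (intro nn_integral_cmult) simp
  also have "(\<integral>\<^sup>+x. emeasure M (Pair x -` W) \<partial>lborel) = (\<integral>\<^sup>+\<omega>. emeasure lborel ((\<lambda>x. (x, \<omega>)) -` W) \<partial>M)"
    using emeasure_pair_measure_alt[OF W] L.emeasure_pair_measure_alt2[OF W] by simp
  also have "ennreal C * \<dots> \<le> ennreal C * (\<integral>\<^sup>+\<omega>. ennreal \<bar>B T \<omega>\<bar> \<partial>M)"
  proof (intro mult_left_mono nn_integral_mono)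
    \<comment> \<open>After the exchange of integrals, the starts in \<open>W\<close> for a fixed
      outcome form an interval whose length is the negative part of
      \<open>B T \<omega>\<close>.\<close>
    fix \<omega> assume "\<omega> \<in> space M"
    then have "(\<lambda>x. (x, \<omega>)) -` W = {R <..< R - B T \<omega>}"
      by (auto simp: W_def space_pair_measure)
    then show "emeasure lborel ((\<lambda>x. (x, \<omega>)) -` W) \<le> ennreal \<bar>B T \<omega>\<bar>"
      by (cases "0 \<le> - B T \<omega>") auto
  qed simp
  also have "(\<integral>\<^sup>+\<omega>. ennreal \<bar>B T \<omega>\<bar> \<partial>M) = ennreal (\<integral>\<omega>. \<bar>B T \<omega>\<bar> \<partial>M)"
    using integrable_B[OF T] by (intro nn_integral_eq_integral) auto
  finally have W_le: "(\<integral>\<^sup>+x. emeasure M (Pair x -` W) \<partial>\<nu>) \<le> ennreal C * ennreal (\<integral>\<omega>. \<bar>B T \<omega>\<bar> \<partial>M)" .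
  have "emeasure \<mu> (dead (\<lambda>_. ereal R) T) = (\<integral>\<^sup>+x. emeasure M (Pair x -` dead (\<lambda>_. ereal R) T) \<partial>\<nu>)"
    by (rule emeasure_pair_measure_alt) simp
  also have "\<dots> \<le> (\<integral>\<^sup>+x. indicator {..R} x + 2 * emeasure M (Pair x -` W) \<partial>\<nu>)"
    by (intro nn_integral_mono sect)
  also have "\<dots> = emeasure \<nu> {..R} + 2 * (\<integral>\<^sup>+x. emeasure M (Pair x -` W) \<partial>\<nu>)"
  proof -
    have [measurable]: "(\<lambda>x. emeasure M (Pair x -` W)) \<in> borel_measurable \<nu>"
      using measurable_emeasure_Pair[OF W] by (simp add: sets_\<nu> cong: measurable_cong_sets)
    show ?thesis
      by (subst nn_integral_add) (auto simp: nn_integral_cmult sets_\<nu>)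
  qed
  also have "\<dots> \<le> emeasure \<nu> {..R} + 2 * (ennreal C * ennreal (\<integral>\<omega>. \<bar>B T \<omega>\<bar> \<partial>M))"
    by (intro add_left_mono mult_left_mono W_le) simp
  also have "2 * (ennreal C * ennreal (\<integral>\<omega>. \<bar>B T \<omega>\<bar> \<partial>M)) = ennreal K"
    using C_nonneg by (simp add: K_def ennreal_mult mult.assoc)
  also have "emeasure \<nu> {..R} + ennreal K \<le> ennreal (R - max (max c 0) K) + ennreal K"
    by (intro add_right_mono R)
  also have "\<dots> \<le> ennreal R"
    using R(1) K by (simp add: ennreal_plus[symmetric] ennreal_leI del: ennreal_plus)
  finally show ?thesis using that R(1) by auto
qed

section \<open>The least fixed point and its finiteness\<close>

definition loss_map :: "(real \<Rightarrow> ereal) \<Rightarrow> real \<Rightarrow> ereal" where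
  "loss_map \<Phi> t = enn2ereal (emeasure \<mu> (dead \<Phi> t))"

text \<open>Extended-real values make the fronts a complete lattice, so the least fixed point exists
  before any bound on the loss is known.\<close>

definition min_loss :: "real \<Rightarrow> ereal" where
  "min_loss = lfp loss_map"

lemma mono_loss_map: "mono loss_map"
  unfolding mono_def le_fun_def loss_map_def less_eq_ennreal.rep_eq[symmetric]
  by (intro allI impI emeasure_mono dead_mono dead_measurable) auto

lemma min_loss_unfold: "min_loss t = enn2ereal (emeasure \<mu> (dead min_loss t))"
  unfolding min_loss_def using lfp_unfold[OF mono_loss_map] by (metis loss_map_def)

text \<open>Comparison principle: the hypothesis makes \<open>\<Phi>\<close> a supersolution, and a
  least fixed point lies below all of these. Upper bounds on the loss come from exhibiting a
  supersolution.\<close>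

lemma min_loss_le:
  assumes "\<And>t. enn2ereal (emeasure \<mu> (dead \<Phi> t)) \<le> \<Phi> t"
  shows "min_loss t \<le> \<Phi> t"
  using lfp_lowerbound[of loss_map \<Phi>] assms by (auto simp: min_loss_def le_fun_def loss_map_def)

text \<open>The front that equals a barrier up to a finite horizon and is infinite afterwards is a
  supersolution. The horizon is \<open>max t 1\<close> because \<open>barrier\<close> asks for a
  positive time.\<close>

lemma min_loss_finite: "\<bar>min_loss t\<bar> \<noteq> \<infinity>"
proof -
  obtain R where R: "0 \<le> R" "emeasure \<mu> (dead (\<lambda>_. ereal R) (max t 1)) \<le> ennreal R"
    by (rule barrier[of "max t 1" 0]) auto
  have "min_loss t \<le> (if t \<le> max t 1 then ereal R else \<infinity>)"
  proof (rule min_loss_le[where \<Phi>="\<lambda>s. if s \<le> max t 1 then ereal R else \<infinity>"])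
    fix s
    show "enn2ereal (emeasure \<mu> (dead (\<lambda>s. if s \<le> max t 1 then ereal R else \<infinity>) s))
      \<le> (if s \<le> max t 1 then ereal R else \<infinity>)"
    proof (cases "s \<le> max t 1")
      case True
      have "emeasure \<mu> (dead (\<lambda>s. if s \<le> max t 1 then ereal R else \<infinity>) s)
          \<le> emeasure \<mu> (dead (\<lambda>_. ereal R) (max t 1))"
        using True by (intro emeasure_mono dead_mono) auto
      also note R(2)
      finally show ?thesis
        using True R(1) by (simp add: less_eq_ennreal.rep_eq enn2ereal_ennreal)
    qed auto
  qed
  moreover have "0 \<le> min_loss t"
    by (subst min_loss_unfold) simp
  ultimately show ?thesis by auto
qed

section \<open>Left-continuous loss and its right-continuous version\<close>

definition loss_left :: "real \<Rightarrow> real" where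
  "loss_left t = real_of_ereal (min_loss t)"

definition killed :: "real \<Rightarrow> (real \<times> 'a) set" where
  "killed t = {p \<in> space \<mu>. \<exists>s\<in>\<rat>. 0 \<le> s \<and> s < t \<and> fst p + B s (snd p) < loss_left s}"

lemma min_loss_eq: "min_loss t = ereal (loss_left t)"
  using min_loss_finite by (simp add: loss_left_def ereal_real')

lemma killed_eq: "killed t = dead min_loss t"
  by (simp add: killed_def dead_def min_loss_eq)

lemma killed_measurable[measurable]: "killed t \<in> sets \<mu>"
  by (simp add: killed_eq)

lemma loss_left_nonneg: "0 \<le> loss_left t"
  unfolding loss_left_def by (subst min_loss_unfold) (simp add: real_of_ereal_pos)

lemma emeasure_killed: "emeasure \<mu> (killed t) = ennreal (loss_left t)"
  using min_loss_unfold[of t] unfolding min_loss_eq killed_eq[symmetric]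
  by (metis e2ennreal_enn2ereal ennreal.abs_eq loss_left_nonneg max.absorb2 e2ennreal_ereal)

lemma killed_mono: "s \<le> t \<Longrightarrow> killed s \<subseteq> killed t"
  by (auto simp: killed_def intro: less_le_trans)

lemma loss_left_mono: "s \<le> t \<Longrightarrow> loss_left s \<le> loss_left t"
  using emeasure_mono[OF killed_mono killed_measurable, of s t]
  by (simp add: emeasure_killed loss_left_nonneg ennreal_le_iff)

lemma loss_left_0: "t \<le> 0 \<Longrightarrow> loss_left t = 0"
proof -
  assume "t \<le> 0"
  then have "killed t = {}" by (auto simp: killed_def)
  then show ?thesis using emeasure_killed[of t] loss_left_nonneg[of t] by simp
qed

text \<open>Crossings counted in \<open>killed t\<close> occur strictly before \<open>t\<close>, so
  \<open>killed t\<close> is an increasing union of earlier killed sets and continuity from below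
  applies.\<close>

lemma loss_left_continuous:
  assumes e: "0 < e"
  obtains d where "0 < d" "\<And>s. t - d < s \<Longrightarrow> s \<le> t \<Longrightarrow> loss_left t - e < loss_left s"
proof -
  define A where "A n = killed (t - 1 / real (Suc n))" for n
  have "incseq A"
    unfolding A_def incseq_Suc_iff by (intro allI killed_mono) (auto simp: field_simps)
  moreover have "(\<Union>n. A n) = killed t"
  proof safe
    fix x \<omega> assume "(x, \<omega>) \<in> killed t"
    then obtain s where s: "s \<in> \<rat>" "0 \<le> s" "s < t" "x + B s \<omega> < loss_left s" "(x, \<omega>) \<in> space \<mu>"
      by (auto simp: killed_def)
    obtain n where "inverse (real (Suc n)) < t - s"
      using reals_Archimedean[of "t - s"] s by auto
    then show "(x, \<omega>) \<in> (\<Union>n. A n)"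
      using s by (auto simp: A_def killed_def inverse_eq_divide intro!: exI[of _ n] bexI[of _ s])
  next
    fix x \<omega> n assume "(x, \<omega>) \<in> A n"
    then show "(x, \<omega>) \<in> killed t"
      unfolding A_def by (rule subsetD[OF killed_mono, rotated]) simp
  qed
  ultimately have "(\<lambda>n. emeasure \<mu> (A n)) \<longlonglongrightarrow> emeasure \<mu> (killed t)"
    using Lim_emeasure_incseq[of A \<mu>] by (force simp: A_def)
  then have "(\<lambda>n. loss_left (t - 1 / real (Suc n))) \<longlonglongrightarrow> loss_left t"
    by (simp add: A_def emeasure_killed loss_left_nonneg tendsto_ennreal_iff)
  then have "eventually (\<lambda>n. loss_left t - e < loss_left (t - 1 / real (Suc n))) sequentially"
    using e by (intro order_tendstoD) auto
  then obtain n where "loss_left t - e < loss_left (t - 1 / real (Suc n))"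
    by (auto simp: eventually_sequentially)
  then show ?thesis
    using loss_left_mono[of "t - 1 / real (Suc n)"]
    by (intro that[of "1 / real (Suc n)"]) (auto intro: less_le_trans)
qed

text \<open>The right limit of \<open>loss_left\<close>, written as an infimum because
  \<open>loss_left\<close> is nondecreasing. This is the solution.\<close>

definition loss :: "real \<Rightarrow> real" where
  "loss t = Inf (loss_left ` {t<..})"

lemma loss_le_loss_left: "t < s \<Longrightarrow> loss t \<le> loss_left s"
  unfolding loss_def using loss_left_nonneg by (intro cINF_lower bdd_belowI2[where m=0]) auto

lemma loss_greatest: "(\<And>s. t < s \<Longrightarrow> z \<le> loss_left s) \<Longrightarrow> z \<le> loss t"
  unfolding loss_def by (intro cINF_greatest) auto

lemma loss_left_le_loss: "loss_left t \<le> loss t"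
  by (intro loss_greatest loss_left_mono) simp

lemma loss_nonneg: "0 \<le> loss t"
  by (intro loss_greatest loss_left_nonneg)

lemma loss_mono: "s \<le> t \<Longrightarrow> loss s \<le> loss t"
  by (intro loss_greatest loss_le_loss_left) simp

lemma loss_right_continuous:
  assumes "0 < e"
  obtains d where "0 < d" "loss_left (t + d) < loss t + e"
proof -
  have "\<not> (\<forall>s>t. loss t + e \<le> loss_left s)"
    using loss_greatest[of t "loss t + e"] assms by auto
  then obtain s where "t < s" "loss_left s < loss t + e" by (auto simp: not_le)
  then show ?thesis using that[of "s - t"] by simp
qed

text \<open>A squeeze between \<open>loss t\<close> and slightly later values of
  \<open>loss_left\<close>. The general \<open>f\<close> lets it serve both \<open>loss\<close> and
  \<open>loss_left\<close>.\<close>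

lemma tendsto_at_right_loss:
  assumes f: "\<And>s. t < s \<Longrightarrow> loss t \<le> f s" "\<And>s u. t < s \<Longrightarrow> s < u \<Longrightarrow> f s \<le> loss_left u"
  shows "(f \<longlongrightarrow> loss t) (at_right t)"
proof (rule tendstoI)
  fix e :: real assume "0 < e"
  then obtain d where d: "0 < d" "loss_left (t + d) < loss t + e"
    by (rule loss_right_continuous)
  have "dist (f s) (loss t) < e" if "t < s" "s < t + d" for s
    using f(1)[OF that(1)] f(2)[OF that] d(2) by (simp add: dist_real_def)
  then show "\<forall>\<^sub>F s in at_right t. dist (f s) (loss t) < e"
    using d(1) unfolding eventually_at_right_field by (intro exI[of _ "t + d"]) auto
qed

lemma loss_at_right: "(loss \<longlongrightarrow> loss t) (at_right t)"
  by (rule tendsto_at_right_loss) (auto intro: loss_mono loss_le_loss_left)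

lemma loss_left_at_right: "(loss_left \<longlongrightarrow> loss t) (at_right t)"
  by (rule tendsto_at_right_loss) (auto intro: loss_left_mono loss_le_loss_left)

lemma loss_at_left: "(loss \<longlongrightarrow> loss_left t) (at_left t)"
proof (rule tendstoI)
  fix e :: real assume "0 < e"
  then obtain d where d: "0 < d" "\<And>s. t - d < s \<Longrightarrow> s \<le> t \<Longrightarrow> loss_left t - e < loss_left s"
    by (rule loss_left_continuous) blast
  have "dist (loss s) (loss_left t) < e" if "t - d < s" "s < t" for s
    using d(2)[of s] that loss_left_le_loss[of s] loss_le_loss_left[of s t]
    by (simp add: dist_real_def)
  then show "\<forall>\<^sub>F s in at_left t. dist (loss s) (loss_left t) < e"
    using d(1) unfolding eventually_at_left_field by (intro exI[of _ "t - d"]) auto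
qed

lemma left_limit_loss: "0 \<le> t \<Longrightarrow> left_limit loss t = loss_left t"
  using tendsto_Lim[OF trivial_limit_at_left_real loss_at_left[of t]] loss_left_0[of t]
  by (simp add: left_limit_def)

lemma cadlag_loss: "cadlag loss"
  using loss_at_right loss_at_left by (auto simp: cadlag_def)

text \<open>Paths are continuous and \<open>loss_left\<close> is left-continuous, so a strict
  crossing persists for a short time to the left. This moves crossing times to rational or dyadic
  ones.\<close>

lemma below_loss_left_open_left:
  assumes \<omega>: "\<omega> \<in> space M" and s: "0 \<le> s" "x + B s \<omega> < loss_left s"
  obtains d where "0 < d" "\<And>r. 0 \<le> r \<Longrightarrow> s - d < r \<Longrightarrow> r \<le> s \<Longrightarrow> x + B r \<omega> < loss_left r"
proof -
  define e where "e = (loss_left s - (x + B s \<omega>)) / 2"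
  have e: "0 < e" using s by (simp add: e_def)
  obtain d1 where d1: "0 < d1" "\<And>r. 0 \<le> r \<Longrightarrow> \<bar>r - s\<bar> < d1 \<Longrightarrow> \<bar>B r \<omega> - B s \<omega>\<bar> < e"
    using continuous_B[OF \<omega> s(1) e] by blast
  obtain d2 where d2: "0 < d2" "\<And>r. s - d2 < r \<Longrightarrow> r \<le> s \<Longrightarrow> loss_left s - e < loss_left r"
    using loss_left_continuous[OF e, of s] by blast
  have "x + B r \<omega> < loss_left r" if "0 \<le> r" "s - min d1 d2 < r" "r \<le> s" for r
  proof -
    have "\<bar>B r \<omega> - B s \<omega>\<bar> < e" using that by (intro d1(2)) auto
    moreover have "loss_left s - e < loss_left r" using that by (intro d2(2)) auto
    moreover have "x + B s \<omega> + e = loss_left s - e" by (simp add: e_def field_simps)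
    ultimately show ?thesis by linarith
  qed
  then show ?thesis using that[of "min d1 d2"] d1(1) d2(1) by auto
qed

lemma killed_down_closed: "(x, \<omega>) \<in> killed t \<Longrightarrow> y \<le> x \<Longrightarrow> (y, \<omega>) \<in> killed t"
  unfolding killed_def by (auto intro: le_less_trans[OF add_right_mono] simp: space_\<mu>)

text \<open>Weak contact of the path from \<open>y\<close> at time \<open>s\<close> becomes a strict
  crossing for the lower start \<open>x\<close> at a rational time just after \<open>s\<close>: the
  path moves by less than \<open>y - x\<close>, and \<open>loss_left\<close> is by then at least
  \<open>loss s\<close>.\<close>

lemma killed_if_hit_above:
  assumes \<omega>: "\<omega> \<in> space M" and s: "0 \<le> s" "s < t" "y + B s \<omega> \<le> loss s" and xy: "x < y"
  shows "(x, \<omega>) \<in> killed t"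
proof -
  obtain d where d: "0 < d" "\<And>r. 0 \<le> r \<Longrightarrow> \<bar>r - s\<bar> < d \<Longrightarrow> \<bar>B r \<omega> - B s \<omega>\<bar> < y - x"
    using continuous_B[OF \<omega> s(1), of "y - x"] xy by auto
  obtain r where r: "r \<in> \<rat>" "s < r" "r < min t (s + d)"
    using Rats_dense_in_real[of s "min t (s + d)"] s d(1) by auto
  have "\<bar>B r \<omega> - B s \<omega>\<bar> < y - x" using r s by (intro d(2)) auto
  moreover have "loss s \<le> loss_left r" using r by (intro loss_le_loss_left)
  ultimately have "x + B r \<omega> < loss_left r" using s by linarith
  then show ?thesis using r s \<omega> by (auto simp: killed_def space_\<mu> intro!: bexI[of _ r])
qed

section \<open>Hitting times and the McKean-Vlasov equation\<close>

definition hit :: "real \<Rightarrow> (real \<times> 'a) set" where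
  "hit t = {p \<in> space \<mu>. \<exists>s. 0 \<le> s \<and> s \<le> t \<and> fst p + B s (snd p) \<le> loss s}"

lemma hitting_time_le_ex:
  assumes "\<omega> \<in> space M" "0 \<le> s" "s \<le> t" "x + B s \<omega> \<le> loss s"
  shows "hitting_time B loss x \<omega> \<le> ereal t"
  unfolding hitting_time_def using assms
  by (intro Inf_lower2[of "ereal s"]) (auto simp: X_def)

text \<open>An infimum only yields contact times close to it, which costs the margin
  \<open>e\<close> in time. The margin in the start pays for strict inequality at a rational
  time.\<close>

lemma hitting_time_le_approx:
  assumes \<omega>: "\<omega> \<in> space M" and le: "hitting_time B loss x \<omega> \<le> ereal t" and e: "0 < e" and y: "y < x"
  shows "(y, \<omega>) \<in> killed (t + e)"
proof -
  have "hitting_time B loss x \<omega> < ereal (t + e)" using le e by (auto intro: le_less_trans)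
  then obtain s where "0 \<le> s" "s < t + e" "x + B s \<omega> \<le> loss s"
    unfolding hitting_time_def Inf_less_iff by (auto simp: X_def)
  then show ?thesis using killed_if_hit_above[OF \<omega> _ _ _ y] by blast
qed

text \<open>Compactness: the approximate crossing times accumulate at some \<open>l \<le> t\<close>.
  A nondecreasing right-continuous front is upper semicontinuous, so the contact survives at
  \<open>l\<close>.\<close>

lemma ex_hit_if_approx:
  assumes \<omega>: "\<omega> \<in> space M" and t: "\<And>k. (x - 1 / real (Suc k), \<omega>) \<in> killed (t + 1 / real (Suc k))"
  shows "(x, \<omega>) \<in> hit t"
proof -
  have "\<exists>s. 0 \<le> s \<and> s < t + 1 / real (Suc k) \<and> x - 1 / real (Suc k) + B s \<omega> < loss_left s" for k
    using t[of k] by (auto simp: killed_def)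
  then obtain s where s: "\<And>k. 0 \<le> s k" "\<And>k. s k < t + 1 / real (Suc k)"
      "\<And>k. x - 1 / real (Suc k) + B (s k) \<omega> < loss_left (s k)"
    by metis
  have inv: "(\<lambda>k. 1 / real (Suc k)) \<longlonglongrightarrow> 0" using LIMSEQ_inverse_real_of_nat by (simp add: inverse_eq_divide)
  have "s k \<in> {0..t + 1}" for k
    using s(1)[of k] s(2)[of k] by (auto intro: order.trans[OF less_imp_le])
  then have "\<exists>l\<in>{0..t + 1}. \<exists>r. strict_mono r \<and> (s \<circ> r) \<longlonglongrightarrow> l"
    using compact_Icc[of 0 "t + 1"] unfolding compact_eq_seq_compact_metric seq_compact_def by auto
  then obtain l r where l: "0 \<le> l" and r: "strict_mono r" "(\<lambda>k. s (r k)) \<longlonglongrightarrow> l"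
    by (auto simp: o_def)
  have inv': "(\<lambda>k. 1 / real (Suc (r k))) \<longlonglongrightarrow> 0"
    using LIMSEQ_subseq_LIMSEQ[OF inv r(1)] by (simp add: o_def)
  have "l \<le> t + 0"
    using s(2) by (intro LIMSEQ_le[OF r(2) tendsto_add[OF tendsto_const inv']]) (auto intro: less_imp_le)
  moreover have "x + B l \<omega> \<le> loss l"
  \<comment> \<open>The times \<open>s (r k)\<close> may approach \<open>l\<close> from the right,
    so the comparison is with \<open>loss_left u\<close> for each \<open>u > l\<close>; the infimum
    over \<open>u\<close> is \<open>loss l\<close>.\<close>
  proof (rule loss_greatest)
    fix u assume u: "l < u"
    have B: "(\<lambda>k. B (s (r k)) \<omega>) \<longlonglongrightarrow> B l \<omega>"
      using continuous_paths[OF \<omega>] l s(1) r(2)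
      by (intro continuous_on_tendsto_compose[where f="\<lambda>t. B t \<omega>"]) auto
    have "eventually (\<lambda>k. s (r k) < u) sequentially"
      using order_tendstoD(2)[OF r(2) u] .
    then have "eventually (\<lambda>k. x - 1 / real (Suc (r k)) + B (s (r k)) \<omega> \<le> loss_left u) sequentially"
    proof eventually_elim
      case (elim k)
      show ?case using s(3)[of "r k"] loss_left_mono[of "s (r k)" u] elim by linarith
    qed
    moreover have "(\<lambda>k. x - 1 / real (Suc (r k)) + B (s (r k)) \<omega>) \<longlonglongrightarrow> x - 0 + B l \<omega>"
      by (intro tendsto_intros inv' B)
    ultimately show "x + B l \<omega> \<le> loss_left u"
      by (auto intro: tendsto_upperbound)
  qed
  ultimately show ?thesis using l \<omega> by (auto simp: hit_def space_\<mu>)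
qed

lemma hitting_time_le_iff:
  assumes \<omega>: "\<omega> \<in> space M"
  shows "hitting_time B loss x \<omega> \<le> ereal t \<longleftrightarrow> (x, \<omega>) \<in> hit t"
proof
  assume "hitting_time B loss x \<omega> \<le> ereal t"
  then show "(x, \<omega>) \<in> hit t"
    by (intro ex_hit_if_approx[OF \<omega>] hitting_time_le_approx[OF \<omega>]) auto
qed (use hitting_time_le_ex[OF \<omega>] in \<open>auto simp: hit_def\<close>)

text \<open>\<open>hit\<close> quantifies over uncountably many times. The approximation in both
  directions rewrites it as a countable intersection of events with rational times.\<close>

lemma hit_measurable[measurable]: "hit t \<in> sets \<mu>"
proof -
  have "hit t = (\<Inter>k. {p \<in> space \<mu>. \<exists>s\<in>\<rat>. (0 \<le> s \<and> s < t + 1 / real (Suc k)) \<and>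
      fst p - 1 / real (Suc k) + B s (snd p) < loss_left s})" (is "_ = (\<Inter>k. ?A k)")
  proof (rule set_eqI)
    fix p :: "real \<times> 'a"
    obtain x \<omega> where p: "p = (x, \<omega>)" by (cases p)
    have A: "(x, \<omega>) \<in> ?A k \<longleftrightarrow> (x - 1 / real (Suc k), \<omega>) \<in> killed (t + 1 / real (Suc k))" for k
      by (simp add: killed_def space_\<mu> conj_assoc)
    show "p \<in> hit t \<longleftrightarrow> p \<in> (\<Inter>k. ?A k)"
    proof (cases "\<omega> \<in> space M")
      case True
      have "(x, \<omega>) \<in> hit t \<longleftrightarrow> (\<forall>k. (x - 1 / real (Suc k), \<omega>) \<in> killed (t + 1 / real (Suc k)))"
        using ex_hit_if_approx[OF True] hitting_time_le_approx[OF True] hitting_time_le_iff[OF True]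
        by (auto simp: del: of_nat_Suc)
      then show ?thesis unfolding p INT_iff A by blast
    qed (auto simp: p hit_def space_\<mu>)
  qed
  also have "\<dots> \<in> sets \<mu>"
  proof (intro sets.countable_INT' image_subsetI sets_ex_rat)
    fix k s assume "0 \<le> s \<and> s < t + 1 / real (Suc k)"
    then have [measurable]: "(\<lambda>p. B s (snd p)) \<in> borel_measurable \<mu>" by (intro B_snd) simp
    show "{p \<in> space \<mu>. fst p - 1 / real (Suc k) + B s (snd p) < loss_left s} \<in> sets \<mu>" by measurable
  qed auto
  finally show ?thesis .
qed

text \<open>The intersection of the sets killed shortly after \<open>t\<close> has mass
  \<open>loss t\<close> by continuity from above. It lies inside \<open>hit t\<close> and misses at
  most one start per outcome.\<close>

lemma emeasure_hit: "emeasure \<mu> (hit t) = ennreal (loss t)"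
proof -
  define E where "E = (\<Inter>n. killed (t + 1 / real (Suc n)))"
  have E[measurable]: "E \<in> sets \<mu>" unfolding E_def by measurable
  have "(\<lambda>n. emeasure \<mu> (killed (t + 1 / real (Suc n)))) \<longlonglongrightarrow> emeasure \<mu> E"
    unfolding E_def
  proof (rule Lim_emeasure_decseq)
    show "decseq (\<lambda>n. killed (t + 1 / real (Suc n)))"
      unfolding decseq_Suc_iff by (intro allI killed_mono) (auto simp: field_simps)
  qed (auto simp: emeasure_killed)
  moreover have "(\<lambda>n. emeasure \<mu> (killed (t + 1 / real (Suc n)))) \<longlonglongrightarrow> ennreal (loss t)"
    unfolding emeasure_killed
  proof (intro tendsto_ennrealI filterlim_compose[OF loss_left_at_right])
    show "filterlim (\<lambda>n. t + 1 / real (Suc n)) (at_right t) sequentially"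
      unfolding filterlim_at using LIMSEQ_inverse_real_of_nat_add[of t]
      by (auto simp: inverse_eq_divide)
  qed
  ultimately have "emeasure \<mu> E = ennreal (loss t)" by (rule LIMSEQ_unique)
  moreover have "emeasure \<mu> (hit t - E) = 0"
  proof (rule null_if_one_point_sections)
    fix \<omega> x y assume *: "(x, \<omega>) \<in> hit t - E" "(y, \<omega>) \<in> hit t - E" "x < y"
    then have \<omega>: "\<omega> \<in> space M" by (auto simp: hit_def space_\<mu>)
    have "hitting_time B loss y \<omega> \<le> ereal t" using * hitting_time_le_iff[OF \<omega>] by auto
    then have "(x, \<omega>) \<in> E" unfolding E_def by (intro INT_I hitting_time_le_approx[OF \<omega> _ _ *(3)]) auto
    then show False using * by simp
  qed simp
  moreover have "E \<subseteq> hit t"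
  proof safe
    fix x \<omega> assume *: "(x, \<omega>) \<in> E"
    then have \<omega>: "\<omega> \<in> space M" by (auto simp: E_def killed_def space_\<mu>)
    have "(x - 1 / real (Suc k), \<omega>) \<in> killed (t + 1 / real (Suc k))" for k
      by (rule killed_down_closed[OF INT_D[OF *[unfolded E_def] UNIV_I]]) simp
    then show "(x, \<omega>) \<in> hit t" by (rule ex_hit_if_approx[OF \<omega>])
  qed
  then have "emeasure \<mu> E + emeasure \<mu> (hit t - E) = emeasure \<mu> (hit t)"
    by (subst plus_emeasure) (auto intro!: arg_cong[where f="emeasure \<mu>"])
  ultimately show ?thesis by simp
qed

text \<open>Translates the mass of a set of pairs into the form of integral used in the definitions
  of a solution and of a physical jump.\<close>

lemma nn_integral_sections:
  assumes A: "A \<in> sets \<mu>"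
  shows "(\<integral>\<^sup>+x\<in>{0..}. ennreal (measure M (Pair x -` A) * g x) \<partial>lborel) = emeasure \<mu> A"
proof -
  have [measurable]: "(\<lambda>x. emeasure M (Pair x -` A)) \<in> borel_measurable borel"
    using measurable_emeasure_Pair[OF A] by (simp add: sets_\<nu> cong: measurable_cong_sets)
  have "emeasure \<mu> A = (\<integral>\<^sup>+x. emeasure M (Pair x -` A) \<partial>\<nu>)"
    by (rule emeasure_pair_measure_alt[OF A])
  also have "\<dots> = (\<integral>\<^sup>+x. ennreal (g x) * indicator {0..} x * emeasure M (Pair x -` A) \<partial>lborel)"
    by (rule nn_integral_\<nu>) simp
  also have "\<dots> = (\<integral>\<^sup>+x\<in>{0..}. ennreal (measure M (Pair x -` A) * g x) \<partial>lborel)"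
    using g_nonneg by (intro nn_integral_cong) (simp add: emeasure_eq_measure ennreal_mult mult_ac)
  finally show ?thesis ..
qed

lemma mckean_vlasov_solution_loss: "mckean_vlasov_solution M B g loss"
  unfolding mckean_vlasov_solution_def
proof (intro conjI allI impI)
  fix t :: real assume "0 \<le> t"
  have "Pair x -` hit t = {\<omega> \<in> space M. hitting_time B loss x \<omega> \<le> ereal t}" for x
    using hitting_time_le_iff[of _ x t] by (auto simp: hit_def space_\<mu>)
  then show "ennreal (loss t) = (\<integral>\<^sup>+x\<in>{0..}. ennreal (measure M {\<omega> \<in> space M.
      hitting_time B loss x \<omega> \<le> ereal t} * g x) \<partial>lborel)"
    using nn_integral_sections[OF hit_measurable[of t]] by (simp add: emeasure_hit)
qed (auto intro: loss_nonneg loss_mono cadlag_loss mono_onI)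

end

section \<open>Physical jumps\<close>

context stefan_problem
begin

definition below :: "real \<Rightarrow> real \<Rightarrow> (real \<times> 'a) set" where
  "below t z = {p \<in> space \<mu>. fst p + B t (snd p) \<le> z}"

text \<open>The total mass absorbed if the front moved to \<open>z\<close> at time \<open>t\<close>.
  The physical condition amounts to comparing it with \<open>z\<close>.\<close>

definition exposed_mass :: "real \<Rightarrow> real \<Rightarrow> ennreal" where
  "exposed_mass t z = emeasure \<mu> (killed t \<union> below t z)"

lemma below_measurable[measurable]: "0 \<le> t \<Longrightarrow> below t z \<in> sets \<mu>"
  unfolding below_def by measurable

lemma exposed_mass_mono: "0 \<le> t \<Longrightarrow> z \<le> w \<Longrightarrow> exposed_mass t z \<le> exposed_mass t w"
  unfolding exposed_mass_def by (intro emeasure_mono) (auto simp: below_def)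

lemma loss_left_le_exposed_mass: "0 \<le> t \<Longrightarrow> ennreal (loss_left t) \<le> exposed_mass t z"
  unfolding exposed_mass_def emeasure_killed[symmetric] by (intro emeasure_mono) auto

lemma emeasure_negative_start: "emeasure \<mu> {p \<in> space \<mu>. fst p < 0} = 0"
proof -
  have "emeasure \<mu> {p \<in> space \<mu>. fst p < 0} = emeasure \<mu> ({..<0} \<times> space M)"
    by (intro arg_cong[where f="emeasure \<mu>"]) (auto simp: space_\<mu>)
  also have "\<dots> = emeasure \<nu> {..<0} * emeasure M (space M)"
    by (rule emeasure_pair_measure_Times) (auto simp: sets_\<nu>)
  also have "emeasure \<nu> {..<0} = 0"
    by (rule emeasure_initial_law_neg) simp
  finally show ?thesis by simp
qed

lemma le_hitting_time_iff:
  "ereal t \<le> hitting_time B loss x \<omega> \<longleftrightarrow> (\<forall>s. 0 \<le> s \<and> s < t \<longrightarrow> loss s < x + B s \<omega>)"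
  unfolding hitting_time_def le_Inf_iff by (force simp: X_def not_le[symmetric])

lemma sets_le_hitting_time: "{p \<in> space \<mu>. ereal t \<le> hitting_time B loss (fst p) (snd p)} \<in> sets \<mu>"
proof -
  have "{p \<in> space \<mu>. ereal t \<le> hitting_time B loss (fst p) (snd p)}
    = space \<mu> - (\<Union>n. hit (t - 1 / real (Suc n)))"
  proof (rule set_eqI)
    fix p
    show "p \<in> {p \<in> space \<mu>. ereal t \<le> hitting_time B loss (fst p) (snd p)} \<longleftrightarrow>
      p \<in> space \<mu> - (\<Union>n. hit (t - 1 / real (Suc n)))"
    proof (cases "p \<in> space \<mu>")
      case p: True
      have "p \<in> (\<Union>n. hit (t - 1 / real (Suc n))) \<longleftrightarrow> (\<exists>s. 0 \<le> s \<and> s < t \<and> fst p + B s (snd p) \<le> loss s)"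
      proof
        assume "p \<in> (\<Union>n. hit (t - 1 / real (Suc n)))"
        then obtain n s where s: "0 \<le> s" "s \<le> t - 1 / real (Suc n)" "fst p + B s (snd p) \<le> loss s"
          by (auto simp: hit_def)
        moreover have "0 < 1 / real (Suc n)" by simp
        ultimately show "\<exists>s. 0 \<le> s \<and> s < t \<and> fst p + B s (snd p) \<le> loss s"
          by (intro exI[of _ s]) linarith
      next
        assume "\<exists>s. 0 \<le> s \<and> s < t \<and> fst p + B s (snd p) \<le> loss s"
        then obtain s where s: "0 \<le> s" "s < t" "fst p + B s (snd p) \<le> loss s" by blast
        obtain n where "inverse (real (Suc n)) < t - s"
          using reals_Archimedean[of "t - s"] s by auto
        then have "s \<le> t - 1 / real (Suc n)" by (simp add: inverse_eq_divide)
        then have "p \<in> hit (t - 1 / real (Suc n))" using s p unfolding hit_def by blast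
        then show "p \<in> (\<Union>n. hit (t - 1 / real (Suc n)))" by blast
      qed
      then show ?thesis using p le_hitting_time_iff[of t "fst p" "snd p"]
        by (simp only: mem_Collect_eq Diff_iff) (meson not_le)
    qed auto
  qed
  also have "\<dots> \<in> sets \<mu>" by measurable
  finally show ?thesis .
qed

text \<open>Removing \<open>killed t\<close> leaves the mass still alive just before
  \<open>t\<close> and not above the new level. It differs from the physical integrand only by null
  sets: at most one start per outcome, and the negative starts.\<close>

lemma exposed_mass_eq:
  assumes t: "0 \<le> t"
  shows "exposed_mass t (loss_left t + x) = ennreal (loss_left t) +
    (\<integral>\<^sup>+y\<in>{0..}. ennreal (measure M {\<omega> \<in> space M.
      X_left B loss y t \<omega> \<in> {0..x} \<and> ereal t \<le> hitting_time B loss y \<omega>} * g y) \<partial>lborel)"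
proof -
  define a where "a = loss_left t"
  define J where "J = {p \<in> space \<mu>. 0 \<le> fst p + B t (snd p) - a \<and> fst p + B t (snd p) - a \<le> x} \<inter>
    {p \<in> space \<mu>. ereal t \<le> hitting_time B loss (fst p) (snd p)}"
  define K where "K = below t (a + x) - killed t"
  \<comment> \<open>At \<open>t = 0\<close> nothing has been killed, so negative starts can lie in
    \<open>K\<close> without lying in \<open>J\<close>. They carry no mass.\<close>
  define Neg where "Neg = {p \<in> space \<mu>. fst p < 0}"
  have Bt[measurable]: "(\<lambda>p. B t (snd p)) \<in> borel_measurable \<mu>" using t by (rule B_snd)
  have J[measurable]: "J \<in> sets \<mu>"
    unfolding J_def by (intro sets.Int sets_le_hitting_time) measurable
  have K[measurable]: "K \<in> sets \<mu>" unfolding K_def using t by measurable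
  have Neg[measurable]: "Neg \<in> sets \<mu>" unfolding Neg_def by measurable
  have sect: "Pair y -` J = {\<omega> \<in> space M. X_left B loss y t \<omega> \<in> {0..x} \<and> ereal t \<le> hitting_time B loss y \<omega>}" for y
    using t by (auto simp: J_def space_\<mu> X_left_def left_limit_loss a_def)
  have JK: "J \<subseteq> K"
  proof safe
    fix y \<omega> assume J: "(y, \<omega>) \<in> J"
    have "(y, \<omega>) \<notin> killed t"
    proof
      assume "(y, \<omega>) \<in> killed t"
      then obtain s where "0 \<le> s" "s < t" "y + B s \<omega> < loss_left s" by (auto simp: killed_def)
      moreover have "\<forall>s. 0 \<le> s \<and> s < t \<longrightarrow> loss s < y + B s \<omega>"
        using J by (simp add: J_def le_hitting_time_iff)
      ultimately show False using loss_left_le_loss[of s] by fastforce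
    qed
    then show "(y, \<omega>) \<in> K" using J by (simp add: K_def J_def below_def algebra_simps)
  qed
  have one: "emeasure \<mu> ((K - J) - Neg) = 0"
  proof (rule null_if_one_point_sections)
    \<comment> \<open>Of two surviving starts the higher one stays strictly above the front before
      \<open>t\<close>, since a contact would have killed the lower one. Hence the higher one
      belongs to \<open>J\<close>.\<close>
    fix \<omega> y z assume y: "(y, \<omega>) \<in> K - J - Neg" and z: "(z, \<omega>) \<in> K - J - Neg" and yz: "y < z"
    then have \<omega>: "\<omega> \<in> space M" and y0: "0 \<le> y"
      by (auto simp: K_def below_def space_\<mu> Neg_def)
    have nk: "(y, \<omega>) \<notin> killed t" using y by (simp add: K_def)
    \<comment> \<open>A survivor is not strictly below \<open>loss_left t\<close> at time
      \<open>t\<close>: the crossing would persist to a rational time before \<open>t\<close>. At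
      \<open>t = 0\<close> the nonnegative start is used instead.\<close>
    have "a \<le> y + B t \<omega>"
    proof (rule ccontr)
      assume "\<not> a \<le> y + B t \<omega>"
      then have lt: "y + B t \<omega> < loss_left t" by (simp add: a_def)
      have "0 < t"
      proof (rule ccontr)
        assume "\<not> 0 < t"
        then have "t = 0" using t by simp
        then show False using lt y0 start_zero[OF \<omega>] loss_left_0[of 0] by simp
      qed
      obtain d where d: "0 < d" "\<And>r. 0 \<le> r \<Longrightarrow> t - d < r \<Longrightarrow> r \<le> t \<Longrightarrow> y + B r \<omega> < loss_left r"
        using below_loss_left_open_left[OF \<omega> t lt] by blast
      obtain r where r: "r \<in> \<rat>" "max 0 (t - d) < r" "r < t"
        using Rats_dense_in_real[of "max 0 (t - d)" t] d(1) \<open>0 < t\<close> by auto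
      then have "y + B r \<omega> < loss_left r" by (intro d(2)) auto
      then have "(y, \<omega>) \<in> killed t"
        using r \<omega> by (auto simp: killed_def space_\<mu> intro!: bexI[of _ r])
      then show False using nk by simp
    qed
    then have "0 \<le> z + B t \<omega> - a" using yz by simp
    moreover have "z + B t \<omega> - a \<le> x" using z by (simp add: K_def below_def)
    moreover have "loss s < z + B s \<omega>" if "0 \<le> s" "s < t" for s
      using killed_if_hit_above[OF \<omega> that _ yz] nk by (meson not_le)
    ultimately have "(z, \<omega>) \<in> J"
      using \<omega> by (simp add: J_def le_hitting_time_iff space_\<mu>)
    then show False using z by simp
  qed measurable
  have "emeasure \<mu> K \<le> emeasure \<mu> (J \<union> ((K - J) - Neg) \<union> Neg)"
    by (intro emeasure_mono) auto
  also have "\<dots> \<le> emeasure \<mu> J + emeasure \<mu> ((K - J) - Neg) + emeasure \<mu> Neg"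
    by (intro order.trans[OF emeasure_subadditive] add_right_mono emeasure_subadditive) auto
  also have "\<dots> = emeasure \<mu> J"
    using one emeasure_negative_start by (simp add: Neg_def)
  finally have "emeasure \<mu> J = emeasure \<mu> K"
    using emeasure_mono[OF JK K] by simp
  moreover have "exposed_mass t (a + x) = emeasure \<mu> (killed t) + emeasure \<mu> K"
    unfolding exposed_mass_def K_def using t by (subst plus_emeasure) (auto intro!: arg_cong[where f="emeasure \<mu>"])
  moreover note nn_integral_sections[OF J]
  ultimately show ?thesis unfolding sect by (simp add: emeasure_killed a_def)
qed

lemma physical_set_iff:
  assumes t: "0 \<le> t" and x: "0 < x"
  shows "(\<integral>\<^sup>+y\<in>{0..}. ennreal (measure M {\<omega> \<in> space M.
      X_left B loss y t \<omega> \<in> {0..x} \<and> ereal t \<le> hitting_time B loss y \<omega>} * g y) \<partial>lborel) < ennreal x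
    \<longleftrightarrow> exposed_mass t (loss_left t + x) < ennreal (loss_left t + x)"
  unfolding exposed_mass_eq[OF t] using x loss_left_nonneg[of t]
  by (simp add: ennreal_plus ennreal_add_left_cancel_less)

text \<open>If the mass exposed by a barrier at \<open>z\<close> is below \<open>z\<close>, then freezing the front at \<open>z\<close> for a
  short time gives a supersolution, which the least solution cannot exceed.\<close>

lemma loss_le_if_exposed_mass_less:
  assumes t: "0 \<le> t" and z: "exposed_mass t z < ennreal z"
  shows "loss t \<le> z"
proof -
  \<comment> \<open>\<open>E n\<close> collects what is absorbed when the front follows the minimal
    one before \<open>t\<close> and is then frozen at \<open>z\<close> for the time
    \<open>1 / real (Suc n)\<close>.\<close>
  define E where "E n = killed t \<union> {p \<in> space \<mu>. \<exists>s\<in>\<rat>. (t \<le> s \<and> s < t + 1 / real (Suc n)) \<and> fst p + B s (snd p) < z}" for n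
  have az: "loss_left t \<le> z"
    using le_less_trans[OF loss_left_le_exposed_mass[OF t] z] loss_left_nonneg[of t]
    by (auto simp: ennreal_less_iff)
  have E[measurable]: "E n \<in> sets \<mu>" for n
    unfolding E_def
  proof (intro sets.Un killed_measurable sets_ex_rat)
    fix s assume "t \<le> s \<and> s < t + 1 / real (Suc n)"
    then have [measurable]: "(\<lambda>p. B s (snd p)) \<in> borel_measurable \<mu>" using t by (intro B_snd) simp
    show "{p \<in> space \<mu>. fst p + B s (snd p) < z} \<in> sets \<mu>" by measurable
  qed
  have dec: "decseq E"
    unfolding decseq_Suc_iff
  proof
    fix n
    have "1 / real (Suc (Suc n)) \<le> 1 / real (Suc n)" by (simp add: field_simps)
    then show "E (Suc n) \<subseteq> E n" unfolding E_def by (blast intro: less_le_trans add_left_mono)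
  qed
  \<comment> \<open>This barrier above \<open>z\<close> makes the sets \<open>E n\<close> finite, as
    continuity from above requires.\<close>
  obtain R where R: "z \<le> R" "emeasure \<mu> (dead (\<lambda>_. ereal R) (t + 2)) \<le> ennreal R"
    using barrier[of "t + 2" z] t by auto
  have fin: "emeasure \<mu> (E n) \<noteq> \<infinity>" for n
  proof -
    have "killed t \<subseteq> dead (\<lambda>_. ereal R) (t + 2)"
      unfolding killed_eq
    proof (rule dead_mono)
      fix s assume "s < t"
      then show "min_loss s \<le> ereal R" using R(1) az loss_left_mono[of s t] by (simp add: min_loss_eq)
    qed simp
    moreover have "{p \<in> space \<mu>. \<exists>s\<in>\<rat>. (t \<le> s \<and> s < t + 1 / real (Suc n)) \<and> fst p + B s (snd p) < z}
        \<subseteq> dead (\<lambda>_. ereal R) (t + 2)"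
    proof safe
      fix x \<omega> s assume *: "(x, \<omega>) \<in> space \<mu>" "s \<in> \<rat>" "t \<le> s" "s < t + 1 / real (Suc n)" "fst (x, \<omega>) + B s (snd (x, \<omega>)) < z"
      have "1 / real (Suc n) \<le> 1" by simp
      then have "s < t + 2" using *(4) by linarith
      then show "(x, \<omega>) \<in> dead (\<lambda>_. ereal R) (t + 2)"
        using * t R(1) unfolding dead_def by (auto intro!: bexI[of _ s])
    qed
    ultimately have "emeasure \<mu> (E n) \<le> emeasure \<mu> (dead (\<lambda>_. ereal R) (t + 2))"
      unfolding E_def by (intro emeasure_mono) auto
    also note R(2)
    also have "ennreal R < \<infinity>" by simp
    finally show ?thesis by simp
  qed
  \<comment> \<open>A path that is not killed before \<open>t\<close> and is strictly above
    \<open>z\<close> at \<open>t\<close> stays above \<open>z\<close> for a short time, so it drops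
    out of \<open>E n\<close> for large \<open>n\<close>.\<close>
  have "(\<Inter>n. E n) \<subseteq> killed t \<union> below t z"
  proof (rule subsetI, rule ccontr)
    fix p assume p: "p \<in> (\<Inter>n. E n)" "p \<notin> killed t \<union> below t z"
    obtain x \<omega> where x: "p = (x, \<omega>)" by (cases p)
    have "p \<in> E 0" using p by blast
    then have sp: "p \<in> space \<mu>" by (auto simp: E_def killed_def)
    then have \<omega>: "\<omega> \<in> space M" by (simp add: x space_\<mu>)
    have "0 < x + B t \<omega> - z" using p sp by (simp add: below_def x)
    then obtain d where d: "0 < d" "\<And>r. 0 \<le> r \<Longrightarrow> \<bar>r - t\<bar> < d \<Longrightarrow> \<bar>B r \<omega> - B t \<omega>\<bar> < x + B t \<omega> - z"
      using continuous_B[OF \<omega> t] by blast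
    obtain n where n: "inverse (real (Suc n)) < d" using reals_Archimedean[OF d(1)] by blast
    have "p \<in> E n" using p by blast
    then obtain s where s: "t \<le> s" "s < t + 1 / real (Suc n)" "x + B s \<omega> < z"
      using p by (auto simp: E_def x)
    have "\<bar>B s \<omega> - B t \<omega>\<bar> < x + B t \<omega> - z"
      using s n t by (intro d(2)) (auto simp: inverse_eq_divide)
    then show False using s(3) by linarith
  qed
  then have "emeasure \<mu> (\<Inter>n. E n) \<le> exposed_mass t z"
    unfolding exposed_mass_def using t by (intro emeasure_mono) auto
  then have "emeasure \<mu> (\<Inter>n. E n) < ennreal z" using z by simp
  moreover have "(\<lambda>n. emeasure \<mu> (E n)) \<longlonglongrightarrow> emeasure \<mu> (\<Inter>n. E n)"
    using dec fin by (intro Lim_emeasure_decseq) auto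
  ultimately have "eventually (\<lambda>n. emeasure \<mu> (E n) < ennreal z) sequentially"
    by (intro order_tendstoD(2))
  then obtain n where n: "emeasure \<mu> (E n) < ennreal z" by (auto simp: eventually_sequentially)
  define u where "u = t + 1 / real (Suc n)"
  have tu: "t < u" by (simp add: u_def)
  \<comment> \<open>The supersolution: the minimal front up to \<open>t\<close>, frozen at
    \<open>z\<close> until \<open>u\<close>, and infinite afterwards.\<close>
  define \<Phi> where "\<Phi> s = (if s \<le> t then ereal (loss_left s) else if s \<le> u then ereal z else \<infinity>)" for s
  have "min_loss u \<le> \<Phi> u"
  proof (rule min_loss_le)
    fix s
    consider "s \<le> t" | "t < s" "s \<le> u" | "u < s" by linarith
    then show "enn2ereal (emeasure \<mu> (dead \<Phi> s)) \<le> \<Phi> s"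
    proof cases
      case 1
      have "dead \<Phi> s \<subseteq> killed s"
        unfolding killed_eq using 1 by (intro dead_mono) (auto simp: \<Phi>_def min_loss_eq)
      then have "emeasure \<mu> (dead \<Phi> s) \<le> ennreal (loss_left s)"
        unfolding emeasure_killed[symmetric] by (intro emeasure_mono) auto
      then show ?thesis
        using 1 loss_left_nonneg[of s] by (simp add: \<Phi>_def less_eq_ennreal.rep_eq enn2ereal_ennreal)
    next
      case 2
      have "dead \<Phi> s \<subseteq> E n"
      proof
        fix p assume "p \<in> dead \<Phi> s"
        then obtain r where r: "r \<in> \<rat>" "0 \<le> r" "r < s" "ereal (fst p + B r (snd p)) < \<Phi> r" "p \<in> space \<mu>"
          by (auto simp: dead_def)
        show "p \<in> E n"
        proof (cases "r < t")
          case True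
          then have "p \<in> killed t" using r by (auto simp: killed_def \<Phi>_def)
          then show ?thesis by (simp add: E_def)
        next
          case False
          then have "fst p + B r (snd p) < z"
            using r 2 az by (auto simp: \<Phi>_def split: if_splits)
          moreover have "t \<le> r" "r < t + 1 / real (Suc n)" using False r 2 by (auto simp: u_def)
          ultimately show ?thesis using r unfolding E_def by blast
        qed
      qed
      then have "emeasure \<mu> (dead \<Phi> s) \<le> emeasure \<mu> (E n)" by (intro emeasure_mono) auto
      also have "\<dots> \<le> ennreal z" using n by simp
      finally show ?thesis
        using 2 az loss_left_nonneg[of t] by (simp add: \<Phi>_def less_eq_ennreal.rep_eq enn2ereal_ennreal)
    next
      case 3
      then show ?thesis using tu by (simp add: \<Phi>_def)
    qed
  qed
  then have "loss_left u \<le> z" using tu by (simp add: \<Phi>_def min_loss_eq)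
  then show ?thesis using loss_le_loss_left[OF tu] by linarith
qed

end

text \<open>Truncating \<open>x + N\<close> from below at \<open>0\<close> gains more than truncating it from above at \<open>\<delta>\<close>
  loses, since the increment \<open>N\<close> is symmetric and \<open>0\<close> is the nearer of the two levels.\<close>

lemma (in standard_brownian_motion) clamped_increment_expectation:
  assumes st: "0 \<le> s" "s < t" and x: "0 \<le> x" "2 * x < \<delta>"
  shows "x < (\<integral>\<omega>. min (max 0 (x + (B s \<omega> - B t \<omega>))) \<delta> \<partial>M)"
proof -
  define f where "f n = min (max 0 (x + n)) \<delta>" for n :: real
  define N where "N \<omega> = B t \<omega> - B s \<omega>" for \<omega>
  have [measurable]: "B s \<in> borel_measurable M" "B t \<in> borel_measurable M" using st by auto
  have [measurable]: "f \<in> borel_measurable borel" unfolding f_def by measurable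
  have [measurable]: "N \<in> borel_measurable M" unfolding N_def by measurable
  have f_bound: "\<bar>f n\<bar> \<le> \<delta>" for n using x by (auto simp: f_def)
  have int: "integrable M (\<lambda>\<omega>. f (N \<omega>))" "integrable M (\<lambda>\<omega>. f (- N \<omega>))"
    using f_bound by (auto intro!: integrable_const_bound[where B=\<delta>])
  \<comment> \<open>For \<open>n\<close> between \<open>-x\<close> and \<open>x\<close> neither
    bound is active and the sum is \<open>2 * x\<close>. Otherwise one term is 0 and the other is
    the minimum of \<open>x + \<bar>n\<bar>\<close> and \<open>\<delta>\<close>, which exceeds
    \<open>2 * x\<close>.\<close>
  have sum: "2 * x \<le> f n + f (- n)" for n
    using x by (auto simp: f_def min_def max_def)
  have sum_less: "2 * x < f n + f (- n)" if "x < n" for n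
    using x that by (auto simp: f_def min_def max_def)
  have "(\<integral>\<omega>. f (- N \<omega>) \<partial>M) = (\<integral>n. f n \<partial>distr M borel (\<lambda>\<omega>. B s \<omega> - B t \<omega>))"
    unfolding N_def by (subst integral_distr) auto
  also have "\<dots> = (\<integral>\<omega>. f (N \<omega>) \<partial>M)"
    unfolding distr_increment_symmetric[OF st(1) less_imp_le[OF st(2)]] N_def
    by (subst integral_distr) auto
  finally have eq: "(\<integral>\<omega>. f (- N \<omega>) \<partial>M) = (\<integral>\<omega>. f (N \<omega>) \<partial>M)" .
  have "2 * x < (\<integral>\<omega>. f (N \<omega>) + f (- N \<omega>) \<partial>M)"
  proof (rule ccontr)
    \<comment> \<open>If strictness failed, the nonnegative \<open>q\<close> would vanish almost
      surely. Then \<open>N \<le> x\<close> almost surely, against the positivity of the normal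
      density on \<open>(x, x + 1)\<close>.\<close>
    define q where "q \<omega> = f (N \<omega>) + f (- N \<omega>) - 2 * x" for \<omega>
    assume "\<not> ?thesis"
    moreover have "integrable M q" unfolding q_def by (intro Bochner_Integration.integrable_diff Bochner_Integration.integrable_add int) simp
    moreover have "(\<integral>\<omega>. q \<omega> \<partial>M) = (\<integral>\<omega>. f (N \<omega>) + f (- N \<omega>) \<partial>M) - 2 * x"
      unfolding q_def using int prob_space by (subst Bochner_Integration.integral_diff) (auto intro!: Bochner_Integration.integrable_add)
    moreover have q: "0 \<le> q \<omega>" for \<omega> using sum by (simp add: q_def)
    ultimately have "AE \<omega> in M. q \<omega> = 0"
      using integral_nonneg_eq_0_iff_AE[of M q] integral_nonneg_AE[of q M] by auto
    then have "AE \<omega> in M. \<not> x < N \<omega>"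
    proof eventually_elim
      case (elim \<omega>)
      then show ?case using sum_less[of "N \<omega>"] by (auto simp: q_def)
    qed
    then have "AE \<omega> in M. \<not> N \<omega> \<in> {x<..<x+1}"
      by eventually_elim auto
    then have "emeasure M {\<omega> \<in> space M. N \<omega> \<in> {x<..<x+1}} = 0"
      by (rule emeasure_eq_0_AE)
    moreover have "N -` {x<..<x+1} \<inter> space M = {\<omega> \<in> space M. N \<omega> \<in> {x<..<x+1}}"
      by auto
    moreover have "emeasure M (N -` {x<..<x+1} \<inter> space M)
        = (\<integral>\<^sup>+n. ennreal (normal_density 0 (sqrt (t - s)) n) * indicator {x<..<x+1} n \<partial>lborel)"
      unfolding N_def by (rule distributed_emeasure[OF normal_increments[OF st]]) auto
    ultimately have "(\<integral>\<^sup>+n. ennreal (normal_density 0 (sqrt (t - s)) n) * indicator {x<..<x+1} n \<partial>lborel) = 0"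
      by simp
    then have "AE n in lborel. ennreal (normal_density 0 (sqrt (t - s)) n) * indicator {x<..<x+1} n = 0"
      by (subst (asm) nn_integral_0_iff_AE) auto
    then have "AE n in lborel. \<not> n \<in> {x<..<x+1}"
    proof eventually_elim
      case (elim n)
      have "0 < normal_density 0 (sqrt (t - s)) n" using st by (intro normal_density_pos) auto
      then show ?case using elim by (auto simp: indicator_def split: if_splits)
    qed
    then have "emeasure lborel {n \<in> space lborel. n \<in> {x<..<x+1}} = 0"
      by (rule emeasure_eq_0_AE)
    moreover have "{n \<in> space lborel. n \<in> {x<..<x+1}} = {x<..<x+1}" by auto
    ultimately have "emeasure lborel {x<..<x+1} = 0" by (simp only:)
    then show False by simp
  qed
  also have "(\<integral>\<omega>. f (N \<omega>) + f (- N \<omega>) \<partial>M) = 2 * (\<integral>\<omega>. f (- N \<omega>) \<partial>M)"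
    using int by (subst Bochner_Integration.integral_add) (auto simp: eq)
  finally show ?thesis by (simp add: f_def N_def)
qed

section \<open>Dyadic grids and the lower bound for jumps\<close>

context stefan_problem
begin

text \<open>A finite-grid version of \<open>killed\<close>: it depends on finitely many positions of
  the path, so independence of increments applies. The clause that drops the grid point
  \<open>t\<close> matches the strict time bound in \<open>killed\<close>.\<close>

definition grid_killed :: "real \<Rightarrow> nat \<Rightarrow> (real \<times> 'a) set" where
  "grid_killed t m = {p \<in> space \<mu>. \<exists>k\<in>{..2 ^ m}. t * real k / 2 ^ m < t \<and>
    fst p + B (t * real k / 2 ^ m) (snd p) < loss_left (t * real k / 2 ^ m)}"

lemma grid_killed_measurable[measurable]: "0 \<le> t \<Longrightarrow> grid_killed t m \<in> sets \<mu>"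
proof -
  assume t: "0 \<le> t"
  then have [measurable]: "(\<lambda>p. B (t * real k / 2 ^ m) (snd p)) \<in> borel_measurable \<mu>" for k
    by (intro B_snd) simp
  show ?thesis unfolding grid_killed_def by measurable
qed

lemma incseq_grid_killed: "incseq (grid_killed t)"
proof (rule incseq_SucI, safe)
  fix m x \<omega> assume "(x, \<omega>) \<in> grid_killed t m"
  then obtain k where k: "(x, \<omega>) \<in> space \<mu>" "k \<le> 2 ^ m" "t * real k / 2 ^ m < t"
    "x + B (t * real k / 2 ^ m) \<omega> < loss_left (t * real k / 2 ^ m)" by (auto simp: grid_killed_def)
  have eq: "t * real (2 * k) / 2 ^ Suc m = t * real k / 2 ^ m" by simp
  have "2 * k \<le> 2 ^ Suc m" using k(2) by simp
  then show "(x, \<omega>) \<in> grid_killed t (Suc m)"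
    using k unfolding grid_killed_def
    by (intro CollectI conjI bexI[of _ "2 * k"]) (simp_all only: eq fst_conv snd_conv atMost_iff)
qed

lemma killed_subset_grid_killed: "killed t \<subseteq> (\<Union>m. grid_killed t m)"
proof safe
  fix x \<omega> assume "(x, \<omega>) \<in> killed t"
  then obtain s where s: "0 \<le> s" "s < t" "x + B s \<omega> < loss_left s" and \<omega>: "\<omega> \<in> space M"
    by (auto simp: killed_def space_\<mu>)
  obtain d where d: "0 < d" "\<And>r. 0 \<le> r \<Longrightarrow> s - d < r \<Longrightarrow> r \<le> s \<Longrightarrow> x + B r \<omega> < loss_left r"
    using below_loss_left_open_left[OF \<omega> s(1,3)] by blast
  obtain m k where mk: "k \<le> 2 ^ m" "s - d < t * real k / 2 ^ m" "t * real k / 2 ^ m \<le> s"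
    using dyadic_approx_below[OF s(1,2) d(1)] .
  have "x + B (t * real k / 2 ^ m) \<omega> < loss_left (t * real k / 2 ^ m)"
    using mk s by (intro d(2)) auto
  moreover have "t * real k / 2 ^ m < t" using mk s by simp
  ultimately show "(x, \<omega>) \<in> (\<Union>m. grid_killed t m)"
    using mk(1) \<omega> unfolding grid_killed_def by (auto simp: space_\<mu>)
qed

text \<open>The positions up to \<open>t\<close> are independent of the increment from
  \<open>t\<close> to \<open>v\<close>, so the random level may be computed from an independent
  outcome.\<close>

lemma emeasure_grid_killed_below_random:
  assumes t: "0 \<le> t" "t \<le> v" and \<kappa>[measurable]: "\<kappa> \<in> borel_measurable borel"
  shows "emeasure \<mu> (grid_killed t m \<union> {p \<in> space \<mu>. fst p + B t (snd p) \<le> \<kappa> (B t (snd p) - B v (snd p))})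
    = (\<integral>\<^sup>+\<omega>. emeasure \<mu> (grid_killed t m \<union> below t (\<kappa> (B t \<omega> - B v \<omega>))) \<partial>M)"
proof -
  define n :: nat where "n = 2 ^ m"
  define u where "u k = t * real k / 2 ^ m" for k
  have u: "mono u" "u 0 = 0" "u n = t" "\<And>k. 0 \<le> u k"
    using t by (auto simp: u_def n_def mono_def intro!: divide_right_mono mult_left_mono)
  have [measurable]: "B t \<in> borel_measurable M" "B v \<in> borel_measurable M" using t by auto
  have Bu[measurable]: "B (u k) \<in> borel_measurable M" for k using u(4) by auto
  define V where "V = (\<lambda>\<omega>. \<lambda>k\<in>{..n}. B (u k) \<omega> - B (u 0) \<omega>)"
  define N where "N = (\<lambda>\<omega>. \<lambda>k\<in>{n}. B v \<omega> - B (u n) \<omega>)"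
  have iv: "indep_var (PiM {..n} (\<lambda>_. borel)) V (PiM {n} (\<lambda>_. borel)) N"
    unfolding V_def N_def using u t by (intro indep_past_increment) auto
  \<comment> \<open>The second component of \<open>q\<close> stands for \<open>B v - B t\<close>,
    whence the minus sign in the argument of \<open>\<kappa>\<close>.\<close>
  define Q where "Q x = {q \<in> space (PiM {..n} (\<lambda>_. borel :: real measure) \<Otimes>\<^sub>M PiM {n} (\<lambda>_. borel :: real measure)).
    (\<exists>k\<in>{..n}. u k < t \<and> x + fst q k < loss_left (u k)) \<or> x + fst q n \<le> \<kappa> (- snd q n)}" for x
  have Q: "Q x \<in> sets (PiM {..n} (\<lambda>_. borel) \<Otimes>\<^sub>M PiM {n} (\<lambda>_. borel))" for x
  proof -
    let ?S = "PiM {..n} (\<lambda>_. borel :: real measure) \<Otimes>\<^sub>M PiM {n} (\<lambda>_. borel :: real measure)"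
    have [measurable]: "(\<lambda>q. fst q n) \<in> borel_measurable ?S" "(\<lambda>q. snd q n) \<in> borel_measurable ?S"
      by (auto intro: measurable_compose[OF measurable_fst measurable_component_singleton]
        measurable_compose[OF measurable_snd measurable_component_singleton])
    have 1: "{q \<in> space ?S. u k < t \<and> x + fst q k < loss_left (u k)} \<in> sets ?S" if "k \<in> {..n}" for k
    proof -
      have [measurable]: "(\<lambda>q. fst q k) \<in> borel_measurable ?S"
        using that by (intro measurable_compose[OF measurable_fst measurable_component_singleton])
      show ?thesis by measurable
    qed
    have 2: "{q \<in> space ?S. x + fst q n \<le> \<kappa> (- snd q n)} \<in> sets ?S" by measurable
    show ?thesis
      unfolding Q_def by (intro sets.sets_Collect_disj sets.sets_Collect_finite_Ex 1 2) simp_all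
  qed
  define A where "A = grid_killed t m \<union> {p \<in> space \<mu>. fst p + B t (snd p) \<le> \<kappa> (B t (snd p) - B v (snd p))}"
  define D where "D \<omega>' = grid_killed t m \<union> below t (\<kappa> (B t \<omega>' - B v \<omega>'))" for \<omega>'
  have [measurable]: "(\<lambda>p. B t (snd p)) \<in> borel_measurable \<mu>" "(\<lambda>p. B v (snd p)) \<in> borel_measurable \<mu>"
    using t by (auto intro!: B_snd)
  have A[measurable]: "A \<in> sets \<mu>" unfolding A_def using t by measurable
  have D[measurable]: "D \<omega>' \<in> sets \<mu>" for \<omega>' unfolding D_def using t by measurable
  have V_space: "V \<omega> \<in> space (PiM {..n} (\<lambda>_. borel))" and N_space: "N \<omega> \<in> space (PiM {n} (\<lambda>_. borel))" for \<omega>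
    by (auto simp: V_def N_def space_PiM)
  have in_Q: "(V \<omega>, N \<omega>') \<in> Q x \<longleftrightarrow> (x, \<omega>) \<in> D \<omega>'" if "\<omega> \<in> space M" for \<omega> \<omega>' x
    using V_space[of \<omega>] N_space[of \<omega>'] that start_zero[OF that] u
    by (auto simp: Q_def D_def V_def N_def grid_killed_def below_def space_\<mu> space_\<nu> space_pair_measure n_def[symmetric] u_def[symmetric])
  have eqA: "Pair x -` A = {\<omega> \<in> space M. (V \<omega>, N \<omega>) \<in> Q x}" for x
    using in_Q by (auto simp: A_def D_def below_def grid_killed_def space_\<mu>)
  have eqD: "Pair x -` D \<omega>' = {\<omega> \<in> space M. (V \<omega>, N \<omega>') \<in> Q x}" for x \<omega>'
    using in_Q by (auto simp: D_def below_def grid_killed_def space_\<mu>)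
  have meas: "case_prod (\<lambda>x \<omega>'. emeasure M (Pair x -` D \<omega>')) \<in> borel_measurable \<mu>"
  proof -
    have [measurable]: "(\<lambda>q. B (u k) (snd q)) \<in> borel_measurable (\<mu> \<Otimes>\<^sub>M M)" for k by measurable
    have "{q \<in> space (\<mu> \<Otimes>\<^sub>M M). (\<exists>k\<in>{..n}. u k < t \<and> fst (fst q) + B (u k) (snd q) < loss_left (u k))
        \<or> fst (fst q) + B t (snd q) \<le> \<kappa> (B t (snd (fst q)) - B v (snd (fst q)))} \<in> sets (\<mu> \<Otimes>\<^sub>M M)"
      by measurable
    also have "{q \<in> space (\<mu> \<Otimes>\<^sub>M M). (\<exists>k\<in>{..n}. u k < t \<and> fst (fst q) + B (u k) (snd q) < loss_left (u k))
        \<or> fst (fst q) + B t (snd q) \<le> \<kappa> (B t (snd (fst q)) - B v (snd (fst q)))}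
      = {q \<in> space (\<mu> \<Otimes>\<^sub>M M). snd q \<in> Pair (fst (fst q)) -` D (snd (fst q))}"
      by (auto simp: D_def grid_killed_def below_def space_\<mu> space_\<nu> space_pair_measure n_def[symmetric] u_def[symmetric])
    finally have sets: "{q \<in> space (\<mu> \<Otimes>\<^sub>M M). snd q \<in> Pair (fst (fst q)) -` D (snd (fst q))} \<in> sets (\<mu> \<Otimes>\<^sub>M M)" .
    have "(\<lambda>p. emeasure M (Pair (fst p) -` D (snd p))) \<in> borel_measurable \<mu>"
      by (rule measurable_emeasure[OF _ sets]) (auto simp: D_def below_def grid_killed_def space_\<mu>)
    then show ?thesis by (simp add: case_prod_beta')
  qed
  have "emeasure \<mu> A = (\<integral>\<^sup>+x. emeasure M (Pair x -` A) \<partial>\<nu>)"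
    by (rule emeasure_pair_measure_alt[OF A])
  also have "\<dots> = (\<integral>\<^sup>+x. \<integral>\<^sup>+\<omega>'. emeasure M (Pair x -` D \<omega>') \<partial>M \<partial>\<nu>)"
    unfolding eqA eqD using emeasure_indep_pair[OF iv Q] by simp
  also have "\<dots> = (\<integral>\<^sup>+\<omega>'. \<integral>\<^sup>+x. emeasure M (Pair x -` D \<omega>') \<partial>\<nu> \<partial>M)"
    by (rule P.Fubini'[OF meas, symmetric])
  also have "\<dots> = (\<integral>\<^sup>+\<omega>'. emeasure \<mu> (D \<omega>') \<partial>M)"
    using emeasure_pair_measure_alt[OF D] by simp
  finally show ?thesis by (simp add: A_def D_def)
qed

text \<open>A path at or below \<open>\<kappa> (B t - B v)\<close> at time \<open>t\<close> is at or
  below \<open>loss t\<close> at \<open>t\<close> or at or below \<open>loss v\<close> at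
  \<open>v\<close>, so it lies in \<open>hit v\<close>. Averaging over the independent increment
  bounds the expectation on each grid, and monotone convergence removes the grid.\<close>

lemma exposed_mass_expectation_le:
  assumes t: "0 \<le> t" "t \<le> v" and \<kappa>[measurable]: "\<kappa> \<in> borel_measurable borel"
    and \<kappa>_le: "\<And>n. \<kappa> n \<le> max (loss t) (loss v + n)"
    and F: "\<And>n. f n \<le> exposed_mass t (\<kappa> n)"
  shows "(\<integral>\<^sup>+\<omega>. f (B t \<omega> - B v \<omega>) \<partial>M) \<le> ennreal (loss v)"
proof -
  define D where "D m \<omega>' = grid_killed t m \<union> below t (\<kappa> (B t \<omega>' - B v \<omega>'))" for m \<omega>'
  have [measurable]: "D m \<omega>' \<in> sets \<mu>" for m \<omega>' unfolding D_def using t by measurable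
  have [measurable]: "B t \<in> borel_measurable M" "B v \<in> borel_measurable M" using t by auto
  have [measurable]: "(\<lambda>p. B t (snd p)) \<in> borel_measurable \<mu>" "(\<lambda>p. B v (snd p)) \<in> borel_measurable \<mu>"
    using t by (auto intro!: B_snd)
  have inc: "incseq (\<lambda>m. D m \<omega>')" for \<omega>'
    using incseq_grid_killed[of t] by (auto simp: D_def incseq_def)
  have grid_hit: "grid_killed t m \<union> {p \<in> space \<mu>. fst p + B t (snd p) \<le> \<kappa> (B t (snd p) - B v (snd p))} \<subseteq> hit v" for m
  proof safe
    fix x \<omega> assume "(x, \<omega>) \<in> grid_killed t m"
    then obtain k where k: "(x, \<omega>) \<in> space \<mu>" "t * real k / 2 ^ m < t"
      "x + B (t * real k / 2 ^ m) \<omega> < loss_left (t * real k / 2 ^ m)" by (auto simp: grid_killed_def)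
    moreover have "loss_left (t * real k / 2 ^ m) \<le> loss (t * real k / 2 ^ m)"
      by (rule loss_left_le_loss)
    ultimately show "(x, \<omega>) \<in> hit v"
      using t unfolding hit_def by (intro CollectI conjI exI[of _ "t * real k / 2 ^ m"]) auto
  next
    fix x \<omega> assume *: "(x, \<omega>) \<in> space \<mu>" "fst (x, \<omega>) + B t (snd (x, \<omega>)) \<le> \<kappa> (B t (snd (x, \<omega>)) - B v (snd (x, \<omega>)))"
    have "x + B t \<omega> \<le> loss t \<or> x + B v \<omega> \<le> loss v"
      using *(2) \<kappa>_le[of "B t \<omega> - B v \<omega>"] by (auto simp: max_def split: if_splits)
    then obtain s where s: "s = t \<or> s = v" "x + B s \<omega> \<le> loss s" by blast
    then have "0 \<le> s" "s \<le> v" using t by auto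
    then show "(x, \<omega>) \<in> hit v" using *(1) s(2) unfolding hit_def by auto
  qed
  have meas: "(\<lambda>\<omega>. emeasure \<mu> (D m \<omega>)) \<in> borel_measurable M" for m
  proof -
    have \<mu>: "sigma_finite_measure \<mu>" ..
    have [measurable]: "grid_killed t m \<in> sets \<mu>" using t(1) by measurable
    have [measurable]: "(\<lambda>q. fst (snd q) + B t (snd (snd q))) \<in> borel_measurable (M \<Otimes>\<^sub>M \<mu>)"
      by (rule measurable_compose[OF measurable_snd, of "\<lambda>p. fst p + B t (snd p)"]) measurable
    have "{q \<in> space (M \<Otimes>\<^sub>M \<mu>). snd q \<in> grid_killed t m \<or>
        fst (snd q) + B t (snd (snd q)) \<le> \<kappa> (B t (fst q) - B v (fst q))} \<in> sets (M \<Otimes>\<^sub>M \<mu>)"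
      by measurable
    also have "{q \<in> space (M \<Otimes>\<^sub>M \<mu>). snd q \<in> grid_killed t m \<or>
        fst (snd q) + B t (snd (snd q)) \<le> \<kappa> (B t (fst q) - B v (fst q))}
      = {q \<in> space (M \<Otimes>\<^sub>M \<mu>). snd q \<in> D m (fst q)}"
      by (auto simp: D_def below_def space_pair_measure)
    finally have sets: "{q \<in> space (M \<Otimes>\<^sub>M \<mu>). snd q \<in> D m (fst q)} \<in> sets (M \<Otimes>\<^sub>M \<mu>)" .
    show ?thesis
      by (rule sigma_finite_measure.measurable_emeasure[OF \<mu> _ sets]) (auto simp: D_def below_def grid_killed_def)
  qed
  have "(\<integral>\<^sup>+\<omega>. f (B t \<omega> - B v \<omega>) \<partial>M) \<le> (\<integral>\<^sup>+\<omega>. (SUP m. emeasure \<mu> (D m \<omega>)) \<partial>M)"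
  proof (rule nn_integral_mono)
    fix \<omega>
    have "f (B t \<omega> - B v \<omega>) \<le> exposed_mass t (\<kappa> (B t \<omega> - B v \<omega>))" by (rule F)
    also have "\<dots> \<le> emeasure \<mu> (\<Union>m. D m \<omega>)"
      unfolding exposed_mass_def D_def using killed_subset_grid_killed[of t] t
      by (intro emeasure_mono) auto
    also have "\<dots> = (SUP m. emeasure \<mu> (D m \<omega>))"
      using inc by (intro SUP_emeasure_incseq[symmetric]) auto
    finally show "f (B t \<omega> - B v \<omega>) \<le> (SUP m. emeasure \<mu> (D m \<omega>))" .
  qed
  also have "\<dots> = (SUP m. \<integral>\<^sup>+\<omega>. emeasure \<mu> (D m \<omega>) \<partial>M)"
  proof (rule nn_integral_monotone_convergence_SUP)
    show "incseq (\<lambda>m \<omega>. emeasure \<mu> (D m \<omega>))"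
      using inc by (intro incseq_SucI le_funI emeasure_mono) (auto dest: incseq_SucD)
  qed (rule meas)
  also have "\<dots> \<le> ennreal (loss v)"
  proof (rule SUP_least)
    fix m
    show "(\<integral>\<^sup>+\<omega>. emeasure \<mu> (D m \<omega>) \<partial>M) \<le> ennreal (loss v)"
      unfolding D_def emeasure_grid_killed_below_random[OF t \<kappa>, symmetric] emeasure_hit[symmetric]
      by (rule emeasure_mono[OF grid_hit]) simp
  qed
  finally show ?thesis .
qed

text \<open>A contact strictly before \<open>t\<close> kills all lower starts, and a contact at
  \<open>t\<close> is counted by \<open>below\<close>. Only one start per outcome can escape
  both.\<close>

lemma loss_le_exposed_mass_loss:
  assumes t: "0 \<le> t" shows "ennreal (loss t) \<le> exposed_mass t (loss t)"
proof -
  have [measurable]: "below t (loss t) \<in> sets \<mu>" using t by measurable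
  have "emeasure \<mu> (hit t - (killed t \<union> below t (loss t))) = 0"
  proof (rule null_if_one_point_sections)
    fix \<omega> x y
    assume *: "(x, \<omega>) \<in> hit t - (killed t \<union> below t (loss t))"
      "(y, \<omega>) \<in> hit t - (killed t \<union> below t (loss t))" "x < y"
    then have \<omega>: "\<omega> \<in> space M" by (auto simp: hit_def space_\<mu>)
    obtain s where s: "0 \<le> s" "s \<le> t" "y + B s \<omega> \<le> loss s" using *(2) by (auto simp: hit_def)
    have "s \<noteq> t" using * s \<omega> by (auto simp: below_def space_\<mu>)
    then have "(x, \<omega>) \<in> killed t" using s by (intro killed_if_hit_above[OF \<omega> s(1) _ s(3) *(3)]) simp
    then show False using * by simp
  qed simp
  moreover have "emeasure \<mu> (hit t) \<le> emeasure \<mu> ((killed t \<union> below t (loss t)) \<union> (hit t - (killed t \<union> below t (loss t))))"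
    by (intro emeasure_mono) auto
  moreover have "\<dots> \<le> emeasure \<mu> (killed t \<union> below t (loss t)) + emeasure \<mu> (hit t - (killed t \<union> below t (loss t)))"
    by (rule emeasure_subadditive) auto
  ultimately show ?thesis by (simp add: exposed_mass_def emeasure_hit)
qed

text \<open>Suppose the exposed mass is at least \<open>z\<close> at all levels \<open>z\<close>
  just above \<open>loss t\<close>. Paths below \<open>loss v + (B t - B v)\<close> at time
  \<open>t\<close> are absorbed by a slightly later \<open>v\<close>. Clamping makes the average
  level exceed \<open>loss v\<close>, so more than \<open>loss v\<close> would be absorbed by time
  \<open>v\<close>.\<close>

lemma ex_exposed_mass_less:
  assumes t: "0 \<le> t" and \<delta>: "0 < \<delta>"
  shows "\<exists>z. loss t < z \<and> z < loss t + \<delta> \<and> exposed_mass t z < ennreal z"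
proof (rule ccontr)
  assume "\<not> ?thesis"
  then have not_less: "ennreal z \<le> exposed_mass t z" if "loss t < z" "z < loss t + \<delta>" for z
    using that by (meson not_le)
  define b where "b = loss t"
  \<comment> \<open>Halving keeps the cap \<open>b + \<eta>\<close> strictly inside the interval on
    which \<open>not_less\<close> holds.\<close>
  define \<eta> where "\<eta> = \<delta> / 2"
  have \<eta>: "0 < \<eta>" "\<eta> < \<delta>" using \<delta> by (auto simp: \<eta>_def)
  have b: "0 \<le> b" by (simp add: b_def loss_nonneg)
  have F: "ennreal (b + min k \<eta>) \<le> exposed_mass t (b + k)" if "0 \<le> k" for k
  proof -
    have "ennreal (b + min k \<eta>) \<le> exposed_mass t (b + min k \<eta>)"
    proof (cases "k = 0")
      \<comment> \<open>The contrary assumption concerns levels strictly above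
        \<open>loss t\<close>; the level \<open>loss t\<close> itself needs its own bound.\<close>
      case True
      then show ?thesis using loss_le_exposed_mass_loss[OF t] \<eta> by (simp add: b_def)
    next
      case False
      then show ?thesis using that \<eta> by (intro not_less) (auto simp: b_def)
    qed
    also have "\<dots> \<le> exposed_mass t (b + k)" by (intro exposed_mass_mono t) auto
    finally show ?thesis .
  qed
  \<comment> \<open>Right-continuity gives \<open>v\<close> so close to \<open>t\<close> that
    \<open>x\<close> stays below \<open>\<eta> / 2\<close>, as the expectation estimate
    needs.\<close>
  obtain d where d: "0 < d" "loss_left (t + d) < loss t + \<eta> / 2"
    using loss_right_continuous[of "\<eta> / 2" t] \<eta>(1) by auto
  define v where "v = t + d / 2"
  have v: "t < v" using d by (simp add: v_def)
  define x where "x = loss v - b"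
  have "loss v \<le> loss_left (t + d)" using d by (intro loss_le_loss_left) (simp add: v_def)
  then have x: "0 \<le> x" "2 * x < \<eta>"
    using d loss_mono[of t v] v by (auto simp: x_def b_def)
  have [measurable]: "B t \<in> borel_measurable M" "B v \<in> borel_measurable M" using t v by auto
  define c where "c n = min (max 0 (x + n)) \<eta>" for n
  have c: "0 \<le> c n" "c n \<le> \<eta>" for n using \<eta> by (auto simp: c_def)
  have [measurable]: "c \<in> borel_measurable borel" unfolding c_def by measurable
  have int: "integrable M (\<lambda>\<omega>. c (B t \<omega> - B v \<omega>))"
    using c by (intro integrable_const_bound[where B=\<eta>]) auto
  have "x < (\<integral>\<omega>. c (B t \<omega> - B v \<omega>) \<partial>M)"
    unfolding c_def by (rule clamped_increment_expectation[OF t v x])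
  moreover have "(\<integral>\<^sup>+\<omega>. ennreal (b + c (B t \<omega> - B v \<omega>)) \<partial>M) \<le> ennreal (loss v)"
  \<comment> \<open>This \<open>\<kappa>\<close> is \<open>max (loss t) (loss v + n)\<close>. The
    cap at \<open>\<eta>\<close> enters only through the lower bound \<open>F\<close>.\<close>
  proof (rule exposed_mass_expectation_le[where \<kappa>="\<lambda>n. b + max 0 (x + n)"])
    fix n show "ennreal (b + c n) \<le> exposed_mass t (b + max 0 (x + n))"
      unfolding c_def by (rule F) simp
  qed (use t v in \<open>auto simp: b_def x_def\<close>)
  moreover have "(\<integral>\<^sup>+\<omega>. ennreal (b + c (B t \<omega> - B v \<omega>)) \<partial>M) = ennreal (b + (\<integral>\<omega>. c (B t \<omega> - B v \<omega>) \<partial>M))"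
    using int b c prob_space by (subst nn_integral_eq_integral) auto
  ultimately show False
    using loss_nonneg[of v] by (auto simp: x_def ennreal_le_iff)
qed

lemma jump_loss: "0 \<le> t \<Longrightarrow> jump loss t = loss t - loss_left t"
  by (simp add: jump_def left_limit_loss)

text \<open>Minimality shows that no admissible \<open>x\<close> is smaller than the jump, and
  admissible levels arbitrarily close above \<open>loss t\<close> show that the infimum is not
  larger.\<close>

lemma physical_solution_loss: "physical_solution M B g loss"
  unfolding physical_solution_def
proof (intro conjI allI impI mckean_vlasov_solution_loss)
  fix t :: real assume t: "0 \<le> t"
  let ?mass = "\<lambda>x. \<integral>\<^sup>+y\<in>{0..}. ennreal (measure M {\<omega> \<in> space M.
      X_left B loss y t \<omega> \<in> {0..x} \<and> ereal t \<le> hitting_time B loss y \<omega>} * g y) \<partial>lborel"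
  have eq: "{ereal x | x. 0 < x \<and> ?mass x < ennreal x}
    = {ereal x | x. 0 < x \<and> exposed_mass t (loss_left t + x) < ennreal (loss_left t + x)}"
    using physical_set_iff[OF t] by blast
  have "ereal (loss t - loss_left t)
    = Inf {ereal x | x. 0 < x \<and> exposed_mass t (loss_left t + x) < ennreal (loss_left t + x)}"
  proof (rule antisym)
    show "ereal (loss t - loss_left t)
        \<le> Inf {ereal x | x. 0 < x \<and> exposed_mass t (loss_left t + x) < ennreal (loss_left t + x)}"
    proof (rule Inf_greatest, safe)
      fix x :: real assume "exposed_mass t (loss_left t + x) < ennreal (loss_left t + x)"
      from loss_le_if_exposed_mass_less[OF t this] show "ereal (loss t - loss_left t) \<le> ereal x" by simp
    qed
    show "Inf {ereal x | x. 0 < x \<and> exposed_mass t (loss_left t + x) < ennreal (loss_left t + x)}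
        \<le> ereal (loss t - loss_left t)"
    proof (rule ereal_le_epsilon2)
      fix e :: real assume "0 < e"
      then obtain z where z: "loss t < z" "z < loss t + e" "exposed_mass t z < ennreal z"
        using ex_exposed_mass_less[OF t] by blast
      then have "Inf {ereal x | x. 0 < x \<and> exposed_mass t (loss_left t + x) < ennreal (loss_left t + x)}
          \<le> ereal (z - loss_left t)"
        using loss_left_le_loss[of t]
        by (intro Inf_lower CollectI exI[of _ "z - loss_left t"]) auto
      also have "\<dots> \<le> ereal (loss t - loss_left t) + ereal e" using z by simp
      finally show "Inf {ereal x | x. 0 < x \<and> exposed_mass t (loss_left t + x) < ennreal (loss_left t + x)}
        \<le> ereal (loss t - loss_left t) + ereal e" .
    qed
  qed
  then show "ereal (jump loss t) = Inf {ereal x | x. 0 < x \<and> ?mass x < ennreal x}"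
    unfolding eq jump_loss[OF t] .
qed

end

section \<open>Jumps at arbitrarily late times\<close>

context stefan_problem
begin

text \<open>A start at most \<open>y\<close> with \<open>B t \<omega> \<le> c\<close> is absorbed by
  its position at time \<open>t\<close> alone. These pairs form a rectangle, whose mass is a
  product.\<close>

lemma initial_mass_prob_le_loss:
  assumes t: "0 \<le> t" and le: "y + c \<le> loss t"
  shows "emeasure \<nu> {..y} * ennreal (prob {\<omega> \<in> space M. B t \<omega> \<le> c}) \<le> ennreal (loss t)"
proof -
  have [measurable]: "B t \<in> borel_measurable M" using t by auto
  have "emeasure \<nu> {..y} * emeasure M {\<omega> \<in> space M. B t \<omega> \<le> c}
      = emeasure \<mu> ({..y} \<times> {\<omega> \<in> space M. B t \<omega> \<le> c})"
    by (rule emeasure_pair_measure_Times[symmetric]) (auto simp: sets_\<nu>)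
  also have "\<dots> \<le> emeasure \<mu> (hit t)"
  proof (intro emeasure_mono hit_measurable subsetI)
    fix p assume "p \<in> {..y} \<times> {\<omega> \<in> space M. B t \<omega> \<le> c}"
    then show "p \<in> hit t"
      using t le unfolding hit_def by (auto simp: space_\<mu> intro!: exI[of _ t])
  qed
  finally show ?thesis by (simp add: emeasure_eq_measure emeasure_hit)
qed

lemma initial_mass_le_twice_loss:
  assumes t: "0 \<le> t"
  shows "emeasure \<nu> {..loss t} \<le> ennreal (2 * loss t)"
proof -
  have "emeasure \<nu> {..loss t} * ennreal (1 / 2) \<le> emeasure \<nu> {..loss t} * ennreal (prob {\<omega> \<in> space M. B t \<omega> \<le> 0})"
    using prob_le_zero_ge_half[OF t] by (intro mult_left_mono ennreal_leI) auto
  also have "\<dots> \<le> ennreal (loss t)"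
    by (rule initial_mass_prob_le_loss[OF t]) simp
  finally have "emeasure \<nu> {..loss t} * ennreal (1 / 2) * ennreal 2 \<le> ennreal (loss t) * ennreal 2"
    by (rule mult_right_mono) simp
  also have "emeasure \<nu> {..loss t} * ennreal (1 / 2) * ennreal 2 = emeasure \<nu> {..loss t}"
    by (simp only: mult.assoc ennreal_mult[symmetric]) simp
  also have "ennreal (loss t) * ennreal 2 = ennreal (2 * loss t)"
    using loss_nonneg[of t] by (simp only: ennreal_mult[symmetric] mult.commute)
  finally show ?thesis .
qed

section \<open>Unbounded loss and skipped levels\<close>

context
  assumes supercritical: "\<And>K. \<exists>R\<ge>K. ennreal (2 * R) < emeasure \<nu> {..R}"
begin

lemma loss_unbounded: "\<exists>t\<ge>0. K \<le> loss t"
proof -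
  obtain R where R: "max 0 (2 * K) \<le> R" "ennreal (2 * R) < emeasure \<nu> {..R}"
    using supercritical by metis
  \<comment> \<open>Quadratic in \<open>R\<close>, so that a fall by \<open>R\<close> has
    probability at least 1/4; the summand 1 keeps \<open>t\<close> positive if
    \<open>R = 0\<close>.\<close>
  define t where "t = (4 * R)\<^sup>2 + 1"
  have t: "0 < t" "4 * R \<le> sqrt t"
    unfolding t_def using R(1) by (auto intro!: real_le_rsqrt add_nonneg_pos)
  have "ennreal (2 * R) * ennreal (1 / 4) \<le> emeasure \<nu> {..R} * ennreal (prob {\<omega> \<in> space M. B t \<omega> \<le> - R})"
    using R prob_le_ge_quarter[of R t] t by (intro mult_mono ennreal_leI) auto
  also have "\<dots> \<le> ennreal (loss t)"
    using t by (intro initial_mass_prob_le_loss) (auto simp: loss_nonneg)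
  finally have "R / 2 \<le> loss t"
    using R(1) loss_nonneg[of t] by (simp add: ennreal_mult[symmetric] ennreal_le_iff del: ennreal_mult')
  then show ?thesis using R(1) t(1) by (intro exI[of _ t]) auto
qed

text \<open>A supercritical \<open>R\<close> is never a value of \<open>loss\<close>. At the first
  time the loss reaches at least \<open>R\<close> it therefore exceeds \<open>R\<close>, while its
  left limit is at most \<open>R\<close>.\<close>

lemma ex_jump_after: "\<exists>t>T. 0 < jump loss t" if T: "0 \<le> T"
proof -
  \<comment> \<open>The summand 1 ensures that \<open>R\<close> has not been reached at time
    \<open>T\<close>.\<close>
  obtain R where R: "loss T + 1 \<le> R" "ennreal (2 * R) < emeasure \<nu> {..R}"
    using supercritical by metis
  obtain u where u: "0 \<le> u" "R \<le> loss u" using loss_unbounded by metis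
  define S where "S = {s. T \<le> s \<and> R \<le> loss s}"
  have "T \<le> u" using u(2) R(1) loss_mono[of u T] by (cases "T \<le> u") auto
  then have ne: "S \<noteq> {}" using u by (auto simp: S_def)
  have bdd: "bdd_below S" by (auto simp: S_def)
  define t where "t = Inf S"
  have "R \<le> loss t"
  proof (rule loss_greatest)
    fix s assume "t < s"
    then obtain r where "r \<in> S" "r < s" using cInf_lessD[OF ne] by (auto simp: t_def)
    then show "R \<le> loss_left s" using loss_le_loss_left[of r s] by (auto simp: S_def)
  qed
  moreover have "T \<le> t" unfolding t_def using ne by (intro cInf_greatest) (auto simp: S_def)
  ultimately have Tt: "T < t" using R(1) by (cases "T = t") auto
  have "loss t \<noteq> R" using initial_mass_le_twice_loss[of t] R(2) T Tt by auto
  then have "R < loss t" using \<open>R \<le> loss t\<close> by simp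
  moreover have "loss_left t \<le> R"
  proof (rule ccontr)
    assume "\<not> loss_left t \<le> R"
    then obtain d where d: "0 < d" "\<And>s. t - d < s \<Longrightarrow> s \<le> t \<Longrightarrow> loss_left t - (loss_left t - R) < loss_left s"
      using loss_left_continuous[of "loss_left t - R" t] by auto
    define s where "s = max T (t - d / 2)"
    have s: "T \<le> s" "s < t" "t - d < s" using Tt d(1) by (auto simp: s_def)
    then have "R < loss s" using d(2)[of s] loss_left_le_loss[of s] by simp
    then have "s \<in> S" using s(1) by (simp add: S_def)
    then have "t \<le> s" unfolding t_def using bdd by (rule cInf_lower)
    then show False using s(2) by simp
  qed
  ultimately have "0 < jump loss t" using T Tt by (simp add: jump_loss)
  then show ?thesis using Tt by blast
qed

lemma ex_jump_sequence:
  "\<exists>t :: nat \<Rightarrow> real. strict_mono t \<and> filterlim t at_top sequentially \<and> (\<forall>i. 0 \<le> t i \<and> 0 < jump loss (t i))"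
proof -
  \<comment> \<open>Gaps larger than 1 between successive jump times force divergence.\<close>
  have "\<exists>t. \<forall>n. (0 \<le> t n \<and> 0 < jump loss (t n)) \<and> t n + 1 < t (Suc n)"
  proof (rule dependent_nat_choice)
    show "\<exists>x. 0 \<le> x \<and> 0 < jump loss x"
      using ex_jump_after[of 0] by (auto intro: less_imp_le)
    fix x :: real assume x: "0 \<le> x \<and> 0 < jump loss x"
    then obtain y where y: "x + 1 < y" "0 < jump loss y"
      using ex_jump_after[of "x + 1"] by auto
    then show "\<exists>y. (0 \<le> y \<and> 0 < jump loss y) \<and> x + 1 < y"
      using x by (intro exI[of _ y]) auto
  qed
  then obtain t where t: "\<And>n. 0 \<le> t n" "\<And>n. 0 < jump loss (t n)" "\<And>n. t n + 1 < t (Suc n)" by blast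
  have "strict_mono t" unfolding strict_mono_Suc_iff using t(3) by (meson less_add_one less_trans)
  moreover have "real n \<le> t n" for n
  proof (induction n)
    case (Suc n)
    then show ?case using t(3)[of n] by simp
  qed (use t in simp)
  then have "filterlim t at_top sequentially"
    by (intro filterlim_at_top_mono[OF filterlim_real_sequentially]) auto
  ultimately show ?thesis using t by blast
qed

end

end

section \<open>Mass estimates for the layered density\<close>

lemma emeasure_initial_law_Icc_le:
  assumes [measurable]: "g \<in> borel_measurable borel" and "a \<le> b" "0 \<le> c" and le: "\<And>x. a \<le> x \<Longrightarrow> x \<le> b \<Longrightarrow> g x \<le> c"
  shows "emeasure (initial_law g) {a..b} \<le> ennreal (c * (b - a))"
proof -
  have "emeasure (initial_law g) {a..b} = (\<integral>\<^sup>+x. ennreal (g x) * indicator {0..} x * indicator {a..b} x \<partial>lborel)"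
    unfolding initial_law_def by (rule emeasure_density) auto
  also have "\<dots> \<le> (\<integral>\<^sup>+x. ennreal c * indicator {a..b} x \<partial>lborel)"
    using le by (intro nn_integral_mono) (auto simp: indicator_def intro: ennreal_leI)
  also have "\<dots> = ennreal (c * (b - a))"
    using assms by (subst nn_integral_cmult_indicator) (auto simp: ennreal_mult)
  finally show ?thesis .
qed

lemma emeasure_initial_law_ge:
  assumes [measurable]: "g \<in> borel_measurable borel" and "0 \<le> a" "a \<le> b" "0 \<le> c"
    and ge: "\<And>x. a < x \<Longrightarrow> x < b \<Longrightarrow> c \<le> g x"
  shows "ennreal (c * (b - a)) \<le> emeasure (initial_law g) {..b}"
proof -
  have "ennreal (c * (b - a)) = (\<integral>\<^sup>+x. ennreal c * indicator {a<..<b} x \<partial>lborel)"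
    using assms by (subst nn_integral_cmult_indicator) (auto simp: ennreal_mult)
  also have "\<dots> \<le> (\<integral>\<^sup>+x. ennreal (g x) * indicator {0..} x * indicator {..b} x \<partial>lborel)"
    using ge assms(2) by (intro nn_integral_mono) (auto simp: indicator_def intro: ennreal_leI)
  also have "\<dots> = emeasure (initial_law g) {..b}"
    unfolding initial_law_def by (rule emeasure_density[symmetric]) auto
  finally show ?thesis .
qed

locale layered_density =
  fixes L :: real
  assumes L: "10 \<le> L"
begin

text \<open>\<open>level n\<close> is \<open>x_hat L (int n - 1)\<close>: the shifted index turns
  the special value at -1 into an empty sum.\<close>

definition level :: "nat \<Rightarrow> real" where
  "level n = (\<Sum>j<n. L ^ j)"

lemma x_hat_eq_level: "x_hat L (int n - 1) = level n"
proof (cases n)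
  case (Suc m)
  then have "int n - 1 = int m" by simp
  then show ?thesis by (simp only: x_hat_def level_def Suc lessThan_Suc_atMost) simp
qed (simp add: x_hat_def level_def)

lemma level_Suc: "level (Suc n) = level n + L ^ n"
  by (simp add: level_def)

lemma level_mono: "m \<le> n \<Longrightarrow> level m \<le> level n"
  unfolding level_def using L by (intro sum_mono2) auto

lemma level_geometric: "(L - 1) * level n = L ^ n - 1"
  unfolding level_def by (rule power_diff_1_eq[symmetric])

lemma level_ge: "real n \<le> level n"
proof (induction n)
  case (Suc n)
  moreover have "1 \<le> L ^ n" using L by (intro one_le_power) simp
  ultimately show ?case by (simp add: level_Suc)
qed (simp add: level_def)

lemma h_eq: "h L (1 / 4) x =
    (if x \<in> (\<Union>i. {level (2 * i)..level (2 * i + 1)}) then 0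
     else if x \<in> (\<Union>i. {level (2 * i + 1)..level (2 * i + 2)}) then 3 / 4 * L
     else 0)"
proof -
  have x_hat: "x_hat L (2 * int i - 1) = level (2 * i)" "x_hat L (2 * int i) = level (2 * i + 1)"
    "x_hat L (2 * int i + 1) = level (2 * i + 2)" for i
    using x_hat_eq_level[of "2 * i"] x_hat_eq_level[of "2 * i + 1"] x_hat_eq_level[of "2 * i + 2"]
    by (simp_all add: algebra_simps)
  have "(1 - 1 / 4) * L = 3 / 4 * L" by simp
  then show ?thesis unfolding h_def x_hat by (rule arg_cong)
qed

lemma h_measurable: "h L (1 / 4) \<in> borel_measurable borel"
proof -
  have [measurable]: "(\<Union>i. {level (2 * i)..level (2 * i + 1)}) \<in> sets borel"
    "(\<Union>i. {level (2 * i + 1)..level (2 * i + 2)}) \<in> sets borel" by auto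
  show ?thesis unfolding h_eq[abs_def] by measurable
qed

lemma h_bounds: "0 \<le> h L (1 / 4) x" "h L (1 / 4) x \<le> 3 / 4 * L"
  using L by (auto simp: h_eq)

lemma h_gap: "level (2 * n) \<le> x \<Longrightarrow> x \<le> level (2 * n + 1) \<Longrightarrow> h L (1 / 4) x = 0"
  by (auto simp: h_eq)

lemma h_layer:
  assumes x: "level (2 * n + 1) < x" "x < level (2 * n + 2)"
  shows "h L (1 / 4) x = 3 / 4 * L"
proof -
  have "x \<notin> {level (2 * i)..level (2 * i + 1)}" for i
    using x level_mono[of "2 * i + 1" "2 * n + 1"] level_mono[of "2 * n + 2" "2 * i"]
    by (cases "i \<le> n") auto
  then have "x \<notin> (\<Union>i. {level (2 * i)..level (2 * i + 1)})" by blast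
  moreover have "x \<in> (\<Union>i. {level (2 * i + 1)..level (2 * i + 2)})"
    using x by (intro UN_I[of n]) auto
  ultimately show ?thesis by (simp only: h_eq if_True if_False)
qed

text \<open>The layer ending at \<open>level (2 * n + 2)\<close> has mass
  \<open>3 / 4 * L ^ (2 * n + 2)\<close>, exactly 3/4 of the length of the gap that follows. Each
  layer is thus paid for by its next gap.\<close>

lemma mass_up_to_gap_le: "emeasure (initial_law (h L (1 / 4))) {..level (2 * n + 1)} \<le> ennreal (3 / 4 * level (2 * n + 1))"
proof (induction n)
  case 0
  have "{..level 1} = {..<0} \<union> {level 0..level 1}" by (auto simp: level_def)
  then have "emeasure (initial_law (h L (1 / 4))) {..level 1} \<le>
      emeasure (initial_law (h L (1 / 4))) {..<0} + emeasure (initial_law (h L (1 / 4))) {level 0..level 1}"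
    using emeasure_subadditive[of "{..<0}" "initial_law (h L (1 / 4))" "{level 0..level 1}"]
    by (simp add: initial_law_def)
  also have "\<dots> \<le> 0 + ennreal (0 * (level 1 - level 0))"
    using h_gap[of 0] level_mono[of 0 1]
    by (intro add_mono emeasure_initial_law_Icc_le) (auto simp: emeasure_initial_law_neg h_measurable)
  finally show ?case by simp
next
  case (Suc n)
  let ?N = "initial_law (h L (1 / 4))"
  have lev: "level (2 * n + 1) \<le> level (2 * n + 2)" "level (2 * n + 2) \<le> level (2 * n + 3)"
    by (auto intro: level_mono)
  have "{..level (2 * n + 3)} = {..level (2 * n + 1)} \<union> {level (2 * n + 1)..level (2 * n + 2)} \<union> {level (2 * n + 2)..level (2 * n + 3)}"
    using lev by auto
  then have "emeasure ?N {..level (2 * n + 3)} \<le> emeasure ?N {..level (2 * n + 1)} +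
      emeasure ?N {level (2 * n + 1)..level (2 * n + 2)} + emeasure ?N {level (2 * n + 2)..level (2 * n + 3)}"
    by (simp only:) (intro order.trans[OF emeasure_subadditive] add_right_mono emeasure_subadditive, auto simp: initial_law_def)
  also have "\<dots> \<le> ennreal (3 / 4 * level (2 * n + 1)) +
      ennreal (3 / 4 * L * (level (2 * n + 2) - level (2 * n + 1))) + ennreal (0 * (level (2 * n + 3) - level (2 * n + 2)))"
    using lev L h_bounds h_gap[of "n + 1"] h_measurable
    by (intro add_mono Suc.IH emeasure_initial_law_Icc_le) (auto simp: numeral_3_eq_3)
  also have "\<dots> = ennreal (3 / 4 * level (2 * n + 1) + 3 / 4 * L * L ^ (2 * n + 1))"
    using L level_ge[of "2 * n + 1"] level_Suc[of "2 * n + 1"] by (simp add: ennreal_plus[symmetric] del: ennreal_plus power_Suc)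
  also have "\<dots> \<le> ennreal (3 / 4 * level (2 * n + 3))"
    using L level_Suc[of "2 * n + 1"] level_Suc[of "2 * n + 2"]
    by (intro ennreal_leI) (simp add: numeral_3_eq_3 algebra_simps)
  finally show ?case by (simp add: numeral_3_eq_3)
qed

text \<open>At the end of a gap at least a quarter of the level is free, and levels grow without
  bound.\<close>

lemma h_subcritical: "\<exists>R\<ge>K. emeasure (initial_law (h L (1 / 4))) {..R} \<le> ennreal (R - K)"
proof -
  obtain n :: nat where n: "4 * \<bar>K\<bar> \<le> real n" using real_arch_simple by blast
  have "4 * \<bar>K\<bar> \<le> level (2 * n + 1)" using n level_ge[of "2 * n + 1"] by simp
  then have "K \<le> level (2 * n + 1)" "3 / 4 * level (2 * n + 1) \<le> level (2 * n + 1) - K" by auto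
  then show ?thesis using mass_up_to_gap_le[of n] by (meson ennreal_leI order.trans)
qed

text \<open>At the end of a layer, \<open>L \<ge> 10\<close> gives
  \<open>9 * R \<le> L ^ (2 * n + 2)\<close>, and the last layer alone has mass
  \<open>3 / 4 * L ^ (2 * n + 2)\<close>, which exceeds \<open>2 * R\<close>.\<close>

lemma h_supercritical: "\<exists>R\<ge>K. ennreal (2 * R) < emeasure (initial_law (h L (1 / 4))) {..R}"
proof -
  obtain n :: nat where n: "K \<le> real n" using real_arch_simple by blast
  let ?R = "level (2 * n + 2)"
  have "K \<le> ?R" using n level_ge[of "2 * n + 2"] by simp
  moreover have "ennreal (2 * ?R) < emeasure (initial_law (h L (1 / 4))) {..?R}"
  proof -
    have "9 * ?R \<le> (L - 1) * ?R" using L level_ge[of "2 * n + 2"] by (intro mult_right_mono) auto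
    then have "9 * ?R \<le> L ^ (2 * n + 2)" using level_geometric[of "2 * n + 2"] by simp
    moreover have "0 < L ^ (2 * n + 2)" using L by simp
    ultimately have "2 * ?R < 3 / 4 * L ^ (2 * n + 2)" by linarith
    also have "\<dots> = 3 / 4 * L * (?R - level (2 * n + 1))"
      using level_Suc[of "2 * n + 1"] by simp
    finally have "ennreal (2 * ?R) < ennreal (3 / 4 * L * (?R - level (2 * n + 1)))"
      using level_ge[of "2 * n + 2"] by (simp add: ennreal_less_iff)
    also have "\<dots> \<le> emeasure (initial_law (h L (1 / 4))) {..?R}"
      using L level_ge[of "2 * n + 1"] level_mono[of "2 * n + 1" "2 * n + 2"] h_layer[of n]
      by (intro emeasure_initial_law_ge h_measurable) auto
    finally show ?thesis .
  qed
  ultimately show ?thesis by blast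
qed

end

theorem proposition6p4:
  fixes M :: "'a measure" and B :: "real \<Rightarrow> 'a \<Rightarrow> real" and L \<alpha> :: real
  assumes "standard_brownian_motion M B"
    and "10 \<le> L" and "\<alpha> = 1 / 4"
  shows "\<exists>\<Lambda>. physical_solution M B (h L \<alpha>) \<Lambda> \<and>
           (\<exists>t :: nat \<Rightarrow> real. strict_mono t \<and> filterlim t at_top sequentially \<and>
              (\<forall>i. 0 \<le> t i \<and> 0 < jump \<Lambda> (t i)))"
proof -
  interpret standard_brownian_motion M B by fact
  interpret layered_density L using assms(2) by unfold_locales
  interpret stefan_problem M B "h L (1 / 4)" "3 / 4 * L"
    by unfold_locales (use h_measurable h_bounds h_subcritical in auto)
  show ?thesis
    unfolding assms(3) using physical_solution_loss ex_jump_sequence[OF h_supercritical] by blast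
qed

end
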